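(* Let $G$ be a $4$-critical graph. Then $G$ contains at least $4$ cycles whose length is divisible by $3$, and $G$ contains exactly $4$ such cycles only if $G$ is the complete graph $K_4$.
   Context: A graph $G$ is $(k+1)$-critical if its chromatic number is $k+1$ but every proper subgraph of $G$ has chromatic number at most $k$. Cycles are counted as subgraphs (distinct edge sets). *)

theory Defs
  imports "HOL-Library.Ramsey"
begin

text \<open>
  A finite simple graph is a vertex set \<open>V\<close> with an edge set \<open>E\<close> of two-element subsets of \<open>V\<close>.
\<close>

definition simple_graph :: "'a set \<Rightarrow> 'a set set \<Rightarrow> bool" where
  "simple_graph V E \<longleftrightarrow> finite V \<and> E \<subseteq> [V]\<^bsup>2\<^esup>"

definition subgraph :: "'a set \<Rightarrow> 'a set set \<Rightarrow> 'a set \<Rightarrow> 'a set set \<Rightarrow> bool" where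
  "subgraph V' E' V E \<longleftrightarrow> simple_graph V' E' \<and> V' \<subseteq> V \<and> E' \<subseteq> E"

definition proper_subgraph :: "'a set \<Rightarrow> 'a set set \<Rightarrow> 'a set \<Rightarrow> 'a set set \<Rightarrow> bool" where
  "proper_subgraph V' E' V E \<longleftrightarrow> subgraph V' E' V E \<and> (V', E') \<noteq> (V, E)"

definition proper_coloring :: "'a set \<Rightarrow> 'a set set \<Rightarrow> nat \<Rightarrow> ('a \<Rightarrow> nat) \<Rightarrow> bool" where
  "proper_coloring V E k c \<longleftrightarrow>
     (\<forall>v\<in>V. c v < k) \<and> (\<forall>u v. {u, v} \<in> E \<longrightarrow> c u \<noteq> c v)"

definition chromatic_number :: "'a set \<Rightarrow> 'a set set \<Rightarrow> nat" where
  "chromatic_number V E = (LEAST k. \<exists>c. proper_coloring V E k c)"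

text \<open>The \<open>LEAST\<close> above is attained on every finite simple graph.\<close>

lemma ex_proper_coloring:
  assumes "simple_graph V E"
  shows "\<exists>k c. proper_coloring V E k c"
proof -
  have "finite V" and E: "E \<subseteq> [V]\<^bsup>2\<^esup>"
    using assms by (auto simp: simple_graph_def)
  then obtain c where c: "bij_betw c V {0..<card V}"
    using ex_bij_betw_finite_nat by blast
  have "c u \<noteq> c v" if "{u, v} \<in> E" for u v
  proof -
    have "{u, v} \<in> [V]\<^bsup>2\<^esup>"
      using that E by (rule subsetD[rotated])
    then have "{u, v} \<subseteq> V" "card {u, v} = 2"
      unfolding nsets_def by simp_all
    then have "u \<in> V" "v \<in> V" "u \<noteq> v"
      by fastforce+
    then show ?thesis
      using bij_betw_imp_inj_on[OF c] by (simp add: inj_on_eq_iff)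
  qed
  moreover have "c v < card V" if "v \<in> V" for v
    using bij_betwE[OF c] that by simp
  ultimately show ?thesis
    unfolding proper_coloring_def by blast
qed

definition critical :: "nat \<Rightarrow> 'a set \<Rightarrow> 'a set set \<Rightarrow> bool" where
  "critical n V E \<longleftrightarrow>
     simple_graph V E \<and> chromatic_number V E = n \<and>
     (\<forall>V' E'. proper_subgraph V' E' V E \<longrightarrow> chromatic_number V' E' < n)"

definition cycle_edges :: "'a list \<Rightarrow> 'a set set" where
  "cycle_edges xs = {{xs ! i, xs ! (Suc i mod length xs)} | i. i < length xs}"

text \<open>
  Cycles are identified with their edge sets, so that rotations and reversals of a vertex
  sequence yield the same cycle, and the length of a cycle \<open>C\<close> is \<open>card C\<close>.
\<close>

definition cycles :: "'a set set \<Rightarrow> 'a set set set" where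
  "cycles E = {C. C \<subseteq> E \<and> (\<exists>xs. distinct xs \<and> 3 \<le> length xs \<and> C = cycle_edges xs)}"

lemma card_cycle_edges:
  assumes "distinct xs" "3 \<le> length xs"
  shows "card (cycle_edges xs) = length xs"
proof -
  let ?n = "length xs"
  let ?f = "\<lambda>i. {xs ! i, xs ! (Suc i mod ?n)}"
  have "inj_on ?f {..<?n}"
  proof (rule inj_onI)
    fix i j
    assume "i \<in> {..<?n}" "j \<in> {..<?n}" and eq: "?f i = ?f j"
    then have ij: "i < ?n" "j < ?n"
      by simp_all
    have suc: "Suc k mod ?n = (if Suc k = ?n then 0 else Suc k)" if "k < ?n" for k
      using that by simp
    have lt: "Suc i mod ?n < ?n" "Suc j mod ?n < ?n"
      using ij by (auto simp: suc)
    have "i = j \<or> (i = Suc j mod ?n \<and> Suc i mod ?n = j)"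
      using eq ij lt unfolding doubleton_eq_iff
      by (metis nth_eq_iff_index_eq[OF assms(1)])
    then show "i = j"
      using assms(2) unfolding suc[OF ij(1)] suc[OF ij(2)] by (simp split: if_splits) linarith
  qed
  moreover have "cycle_edges xs = ?f ` {..<?n}"
    by (auto simp: cycle_edges_def)
  ultimately show ?thesis
    by (simp add: card_image)
qed

definition complete_graph :: "nat \<Rightarrow> 'a set \<Rightarrow> 'a set set \<Rightarrow> bool" where
  "complete_graph n V E \<longleftrightarrow> finite V \<and> card V = n \<and> E = [V]\<^bsup>2\<^esup>"

end

theory Submission
  imports Defs
begin

text \<open>
  Call a cycle of length divisible by 3 a zero cycle. Colour \<open>G - e\<close>, \<open>e = {u, v}\<close>, with colours
  modulo 3 and orient every edge from its colour to the next one; directed cycles are zero cycles.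
  Shifting the colours of the vertices reachable from \<open>u\<close> by 1 shows that \<open>u\<close> and \<open>v\<close> lie in one
  strong component \<open>K\<close>. If an arc \<open>f\<close> separates \<open>u\<close> from \<open>v\<close>, the same shift in the digraph
  without \<open>f\<close> colours \<open>G - f\<close>, and the strong component of \<open>f\<close> there contains \<open>e\<close> and the rest of
  every path from \<open>u\<close> to \<open>v\<close> in \<open>K\<close>.

  This exchange of \<open>e\<close> for \<open>f\<close> shows that some \<open>e\<close> lies on two zero cycles \<open>C1\<close>, \<open>C2\<close>, and that \<open>K\<close>
  contains two directed cycles \<open>A\<close>, \<open>B\<close> unless there are five zero cycles. So there are at least
  four. Suppose there are no others. If \<open>K\<close> spans \<open>G\<close>, then \<open>K\<close> has at most one vertex of
  out-degree 2 and at most one of in-degree 2, and minimum degree 3 leaves only \<open>K_4\<close>. If \<open>w\<close> lies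
  outside \<open>K\<close>, then \<open>C1\<close> and \<open>C2\<close> both pass through \<open>w\<close>, without a common edge there; further
  exchanges make \<open>A\<close> and \<open>B\<close> two triangles that share a vertex \<open>t\<close>, with \<open>u\<close> on one and \<open>v\<close>
  on the other, and then the triangle \<open>u t v\<close> is one of \<open>C1\<close>, \<open>C2\<close> but misses \<open>w\<close>.
\<close>

section \<open>Directed cycles\<close>

text \<open>A cycle of length \<open>n\<close> is an \<open>n\<close>-periodic sequence indexed by the integers, so that
  rotating and reversing it are affine substitutions.\<close>

definition periodic :: "int \<Rightarrow> (int \<Rightarrow> 'a) \<Rightarrow> bool" where
  "periodic n p \<longleftrightarrow> 0 < n \<and> (\<forall>i j. p i = p j \<longleftrightarrow> i mod n = j mod n)"

definition steps :: "(int \<Rightarrow> 'a) \<Rightarrow> ('a \<times> 'a) set" where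
  "steps p = range (\<lambda>i. (p i, p (i + 1)))"

text \<open>Loops and 2-cycles are allowed here. In the digraphs of 3-colourings below they cannot
  occur, because there every length is divisible by 3.\<close>

definition dcycles :: "('a \<times> 'a) set \<Rightarrow> ('a \<times> 'a) set set" where
  "dcycles R = {X. X \<subseteq> R \<and> (\<exists>n p. periodic n p \<and> X = steps p)}"

text \<open>The strong component of \<open>u\<close>, given by its arcs rather than its vertices, so
  that it can be compared directly with directed cycles.\<close>

definition strong :: "('a \<times> 'a) set \<Rightarrow> 'a \<Rightarrow> ('a \<times> 'a) set" where
  "strong R u = {(x, y) \<in> R. (u, x) \<in> R\<^sup>* \<and> (y, u) \<in> R\<^sup>*}"

lemma stepsI: "(p i, p (i + 1)) \<in> steps p"
  by (auto simp: steps_def)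

lemma periodic_shift:
  assumes "periodic n p" shows "periodic n (\<lambda>i. p (k + i))"
proof -
  have "(k + i) mod n = (k + j) mod n \<longleftrightarrow> i mod n = j mod n" for i j
    by (simp add: mod_eq_dvd_iff)
  then show ?thesis using assms by (auto simp: periodic_def)
qed

lemma periodic_reflect:
  assumes "periodic n p" shows "periodic n (\<lambda>i. p (k - i))"
proof -
  have "(k - i) mod n = (k - j) mod n \<longleftrightarrow> i mod n = j mod n" for i j
    by (auto simp: mod_eq_dvd_iff dvd_diff_commute)
  then show ?thesis using assms by (auto simp: periodic_def)
qed

lemma steps_shift: "steps (\<lambda>i. p (k + i)) = steps p"
proof -
  have "(p i, p (i + 1)) \<in> steps (\<lambda>i. p (k + i))" for i
    using stepsI[of "\<lambda>i. p (k + i)" "i - k"] by (simp add: algebra_simps)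
  moreover have "(p (k + i), p (k + (i + 1))) \<in> steps p" for i
    using stepsI[of p "k + i"] by (simp add: algebra_simps)
  ultimately show ?thesis unfolding steps_def by (auto simp: steps_def)
qed

lemma steps_reflect: "steps (\<lambda>i. p (k - i)) = (steps p)\<inverse>"
proof -
  have "(p (i + 1), p i) \<in> steps (\<lambda>i. p (k - i))" for i
    using stepsI[of "\<lambda>i. p (k - i)" "k - i - 1"] by (simp add: algebra_simps)
  moreover have "(p (k - (i + 1)), p (k - i)) \<in> steps p" for i
    using stepsI[of p "k - i - 1"] by (simp add: algebra_simps)
  ultimately show ?thesis unfolding steps_def by (auto simp: steps_def)
qed

lemma dcyclesD: "X \<in> dcycles R \<Longrightarrow> X \<subseteq> R"
  by (simp add: dcycles_def)

lemma dcycles_mono: "X \<in> dcycles R \<Longrightarrow> R \<subseteq> S \<Longrightarrow> X \<in> dcycles S"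
  by (auto simp: dcycles_def)

lemma dcycles_converse: "X \<in> dcycles R \<Longrightarrow> X\<inverse> \<in> dcycles (R\<inverse>)"
  unfolding dcycles_def using steps_reflect[of _ 0] periodic_reflect[of _ _ 0] by blast

lemma dcycles_out_unique:
  assumes "X \<in> dcycles R" "(x, y) \<in> X" "(x, z) \<in> X" shows "y = z"
proof -
  obtain n p where p: "periodic n p" and X: "X = steps p"
    using assms(1) by (auto simp: dcycles_def)
  obtain i j where "p i = p j" "y = p (i + 1)" "z = p (j + 1)"
    using assms(2,3) unfolding X steps_def by auto
  then show ?thesis using p unfolding periodic_def by (metis mod_add_cong)
qed

lemma dcycles_out:
  assumes "X \<in> dcycles R" "x \<in> Field X" shows "\<exists>y. (x, y) \<in> X"
proof -
  obtain n p where X: "X = steps p"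
    using assms(1) by (auto simp: dcycles_def)
  then obtain i where "x = p i" using assms(2) by (auto simp: Field_def steps_def)
  then show ?thesis using X stepsI by metis
qed

lemma dcycles_in:
  assumes "X \<in> dcycles R" "x \<in> Field X" shows "\<exists>y. (y, x) \<in> X"
  using dcycles_out[OF dcycles_converse[OF assms(1)]] assms(2) by auto

lemma steps_walk:
  fixes i k :: int
  assumes "0 \<le> k" "\<And>j. i \<le> j \<Longrightarrow> j < i + k \<Longrightarrow> (p j, p (j + 1)) \<in> R"
  shows "(p i, p (i + k)) \<in> R\<^sup>*"
  using assms
proof (induction k rule: int_ge_induct)
  case (step k)
  have "(p i, p (i + k)) \<in> R\<^sup>*" using step.IH step.prems step.hyps by auto
  moreover have "(p (i + k), p (i + k + 1)) \<in> R" using step.prems step.hyps by auto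
  ultimately show ?case by (simp add: add.assoc rtrancl.rtrancl_into_rtrancl)
qed simp

lemma dcycles_connected:
  assumes "X \<in> dcycles R" "x \<in> Field X" "y \<in> Field X" shows "(x, y) \<in> X\<^sup>*"
proof -
  obtain n p where p: "periodic n p" and X: "X = steps p"
    using assms(1) by (auto simp: dcycles_def)
  obtain i j where ij: "x = p i" "y = p j"
    using assms(2,3) X by (fastforce simp: Field_def steps_def)
  have "p (i + (j - i) mod n) = p j"
    using p unfolding periodic_def by (simp add: mod_add_right_eq)
  moreover have "(p i, p (i + (j - i) mod n)) \<in> X\<^sup>*"
    by (rule steps_walk) (use p X in \<open>auto simp: periodic_def steps_def\<close>)
  ultimately show ?thesis using ij by simp
qed

text \<open>A shortest walk from \<open>a\<close> back to \<open>s\<close> repeats no vertex, so the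
  arc \<open>(s, a)\<close> closes it up to a directed cycle.\<close>

lemma closed_walk_dcycle:
  assumes "(s, a) \<in> R" "(a, s) \<in> R\<^sup>*"
  shows "\<exists>X \<in> dcycles R. (s, a) \<in> X"
proof -
  define m where "m = (LEAST m. (a, s) \<in> R ^^ m)"
  have "\<exists>m. (a, s) \<in> R ^^ m" using assms(2) by (simp add: rtrancl_power)
  then have m: "(a, s) \<in> R ^^ m" unfolding m_def by (rule LeastI_ex)
  then obtain f where f: "f 0 = a" "f m = s" "\<And>i. i < m \<Longrightarrow> (f i, f (Suc i)) \<in> R"
    by (auto simp: relpow_fun_conv)
  have walk: "(f i, f j) \<in> R ^^ (j - i)" if "i \<le> j" "j \<le> m" for i j
    unfolding relpow_fun_conv using f(3) that by (intro exI[of _ "\<lambda>k. f (i + k)"]) auto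
  have inj: "f i \<noteq> f j" if "i < j" "j \<le> m" for i j
  proof
    assume eq: "f i = f j"
    have "(f 0, f i) \<in> R ^^ i" using walk[of 0 i] that by simp
    moreover have "(f i, f m) \<in> R ^^ (m - j)" using walk[of j m] that eq by simp
    ultimately have "(a, s) \<in> R ^^ (i + (m - j))"
      using f(1,2) by (auto simp: relpow_add)
    then have "m \<le> i + (m - j)" unfolding m_def by (rule Least_le)
    then show False using that by simp
  qed
  \<comment> \<open>The walk has \<open>m + 1\<close> vertices; the step that wraps from index
    \<open>m\<close> to index 0 is the arc \<open>(s, a)\<close>.\<close>
  define n where "n = int m + 1"
  define p where "p i = f (nat (i mod n))" for i
  have n: "0 < n" by (simp add: n_def)
  have lt: "nat (i mod n) \<le> m" for i
    using n pos_mod_bound[of n i] by (simp add: n_def)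
  have per: "periodic n p"
    unfolding periodic_def
  proof (intro conjI allI n)
    fix i j
    have "p i = p j \<longleftrightarrow> nat (i mod n) = nat (j mod n)"
    proof (cases "nat (i mod n)" "nat (j mod n)" rule: linorder_cases)
      case less
      then show ?thesis using inj[OF less lt] unfolding p_def by (metis less_irrefl)
    next
      case greater
      then show ?thesis using inj[OF greater lt] unfolding p_def by (metis less_irrefl)
    qed (simp add: p_def)
    also have "\<dots> \<longleftrightarrow> i mod n = j mod n"
      using n by (simp add: eq_nat_nat_iff)
    finally show "p i = p j \<longleftrightarrow> i mod n = j mod n" .
  qed
  have step: "(p i, p (i + 1)) \<in> R" for i
  proof (cases "i mod n = int m")
    case True
    then have "(i + 1) mod n = 0"
      using mod_add_left_eq[of i n 1] by (simp add: n_def)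
    then show ?thesis using True f assms(1) by (simp add: p_def)
  next
    case False
    then have *: "i mod n < int m" "0 \<le> i mod n" using n pos_mod_bound[of n i] by (auto simp: n_def)
    then have "(i + 1) mod n = i mod n + 1"
      using mod_add_left_eq[of i n 1] by (simp add: n_def)
    then show ?thesis using * f(3)[of "nat (i mod n)"] by (simp add: p_def nat_add_distrib)
  qed
  have "steps p \<in> dcycles R"
    using per step by (auto simp: dcycles_def steps_def)
  moreover have "(s, a) = (p (int m), p (int m + 1))"
    using f by (simp add: p_def n_def)
  ultimately show ?thesis using stepsI by metis
qed

text \<open>The head of the arc gets back to its tail through \<open>u\<close>, and a cycle through
  one arc of a strong component never leaves the component.\<close>

lemma strong_dcycle:
  assumes "(x, y) \<in> strong R u"
  shows "\<exists>X \<in> dcycles R. (x, y) \<in> X \<and> X \<subseteq> strong R u"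
proof -
  have *: "(x, y) \<in> R" "(u, x) \<in> R\<^sup>*" "(y, u) \<in> R\<^sup>*"
    using assms unfolding strong_def by blast+
  have "(y, x) \<in> R\<^sup>*" using *(3,2) by (rule rtrancl_trans)
  from closed_walk_dcycle[OF *(1) this] obtain X where X: "X \<in> dcycles R" "(x, y) \<in> X" ..
  have "(a, b) \<in> strong R u" if ab: "(a, b) \<in> X" for a b
  proof -
    have sub: "X\<^sup>* \<subseteq> R\<^sup>*" using dcyclesD[OF X(1)] by (rule rtrancl_mono)
    have fld: "a \<in> Field X" "b \<in> Field X" "x \<in> Field X"
      using ab X(2) by (auto simp: Field_def)
    have "(u, a) \<in> R\<^sup>*"
      by (rule rtrancl_trans[OF *(2) subsetD[OF sub dcycles_connected[OF X(1) fld(3,1)]]])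
    moreover have "(x, u) \<in> R\<^sup>*" using *(1,3) by (rule converse_rtrancl_into_rtrancl)
    then have "(b, u) \<in> R\<^sup>*"
      by (rule rtrancl_trans[OF subsetD[OF sub dcycles_connected[OF X(1) fld(2,3)]]])
    moreover have "(a, b) \<in> R" using ab dcyclesD[OF X(1)] by (rule rev_subsetD)
    ultimately show ?thesis by (simp add: strong_def)
  qed
  then have "X \<subseteq> strong R u" by (rule subrelI)
  then show ?thesis using X by blast
qed

text \<open>The walk can be stopped at its first visit to \<open>n\<close>.\<close>

lemma rtrancl_no_leave: "(z, n) \<in> X\<^sup>* \<Longrightarrow> (z, n) \<in> (X - {n} \<times> UNIV)\<^sup>*"
proof (induction rule: converse_rtrancl_induct)
  case (step y z)
  then show ?case by (cases "y = n") (auto intro: converse_rtrancl_into_rtrancl)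
qed simp

text \<open>The walk can be started at its last visit to \<open>n\<close>; this is the previous fact
  for the converse relation.\<close>

lemma rtrancl_no_return:
  assumes "(n, z) \<in> X\<^sup>*" shows "(n, z) \<in> (X - UNIV \<times> {n})\<^sup>*"
proof -
  have "X\<inverse> - {n} \<times> UNIV = (X - UNIV \<times> {n})\<inverse>" by auto
  moreover have "(z, n) \<in> (X\<inverse>)\<^sup>*" using assms by (rule rtrancl_converseI)
  ultimately have "(z, n) \<in> ((X - UNIV \<times> {n})\<inverse>)\<^sup>*" using rtrancl_no_leave by metis
  then show ?thesis by (rule rtrancl_converseD)
qed

text \<open>Leave \<open>s\<close> along \<open>X\<close> and change to \<open>Y\<close> at
  \<open>t\<close>. The resulting cycle uses \<open>(s, a)\<close>, which \<open>Y\<close> lacks,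
  and cannot use \<open>(t, c)\<close>, the arc by which \<open>X\<close> leaves
  \<open>t\<close>.\<close>

lemma dcycles_switch:
  assumes X: "X \<in> dcycles R" and Y: "Y \<in> dcycles R"
    and s: "(s, a) \<in> X" "(s, b) \<in> Y" "a \<noteq> b"
    and t: "(t, c) \<in> X" "(t, d) \<in> Y" "c \<noteq> d" and "s \<noteq> t"
  shows "\<exists>Z \<in> dcycles R. Z \<noteq> X \<and> Z \<noteq> Y \<and> (s, a) \<in> Z"
proof -
  define Q where "Q = (X - {t} \<times> UNIV) \<union> (Y - {s} \<times> UNIV)"
  have "a \<in> Field X" "t \<in> Field X" "t \<in> Field Y" "s \<in> Field Y" using s t by (auto simp: Field_def)
  then have "(a, t) \<in> X\<^sup>*" "(t, s) \<in> Y\<^sup>*"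
    using dcycles_connected X Y by metis+
  then have "(a, t) \<in> (X - {t} \<times> UNIV)\<^sup>*" "(t, s) \<in> (Y - {s} \<times> UNIV)\<^sup>*"
    by (auto intro: rtrancl_no_leave)
  then have "(a, t) \<in> Q\<^sup>*" "(t, s) \<in> Q\<^sup>*"
    unfolding Q_def by (auto intro: in_rtrancl_UnI)
  moreover have "(s, a) \<in> Q" using s \<open>s \<noteq> t\<close> by (auto simp: Q_def)
  ultimately obtain Z where Z: "Z \<in> dcycles Q" "(s, a) \<in> Z"
    using closed_walk_dcycle by (metis rtrancl_trans)
  have "Q \<subseteq> R" using dcyclesD X Y by (auto simp: Q_def)
  moreover have "(t, c) \<notin> Z"
    using dcyclesD[OF Z(1)] t dcycles_out_unique[OF Y t(2), of c] by (auto simp: Q_def)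
  moreover have "(s, a) \<notin> Y" using s dcycles_out_unique[OF Y] by blast
  ultimately show ?thesis using Z t(1) dcycles_mono[OF Z(1)] by blast
qed

text \<open>Every path from \<open>s\<close> to \<open>t\<close>, closed up by one fixed path back to \<open>s\<close>, contains a cycle
  through its first arc and the last arc \<open>h\<close> of the path back; as \<open>h\<close> lies on only one cycle,
  all these first arcs coincide.\<close>

lemma unique_dcycles_cut:
  assumes uniq: "\<And>X Y h. X \<in> dcycles R \<Longrightarrow> Y \<in> dcycles R \<Longrightarrow> h \<in> X \<Longrightarrow> h \<in> Y \<Longrightarrow> h \<in> strong R s \<Longrightarrow> X = Y"
    and st: "(s, t) \<in> R\<^sup>*" "(t, s) \<in> R\<^sup>*" "s \<noteq> t"
  shows "\<exists>a. (s, a) \<in> R \<and> (s, t) \<notin> (R - {(s, a)})\<^sup>*"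
proof -
  define N where "N = R - UNIV \<times> {s}"
  have "(t, s) \<in> (R - {s} \<times> UNIV)\<^sup>*" using st by (simp add: rtrancl_no_leave)
  then obtain z where z: "(t, z) \<in> (R - {s} \<times> UNIV)\<^sup>*" "(z, s) \<in> R" "z \<noteq> s"
    using \<open>s \<noteq> t\<close> by (auto elim: rtranclE)
  have "(t, z') \<in> N\<^sup>*" if "(t, z') \<in> (R - {s} \<times> UNIV)\<^sup>*" "z' \<noteq> s" for z'
    using that
  proof (induction rule: rtrancl_induct)
    case (step y z)
    then show ?case by (auto simp: N_def intro: rtrancl_into_rtrancl)
  qed simp
  with z have tz: "(t, z) \<in> N\<^sup>*" by blast
  have tzR: "(t, z) \<in> R\<^sup>*" using tz by (rule set_rev_mp[OF _ rtrancl_mono]) (auto simp: N_def)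
  have h: "(z, s) \<in> strong R s"
    using st z tzR by (auto simp: strong_def)
  have first: "\<exists>X \<in> dcycles R. (s, a) \<in> X \<and> (z, s) \<in> X" if a: "(s, a) \<in> N" "(a, t) \<in> N\<^sup>*" for a
  proof -
    define Q where "Q = {(s, a), (z, s)} \<union> N"
    have "(a, z) \<in> N\<^sup>*" using a(2) tz by (rule rtrancl_trans)
    then have "(a, z) \<in> Q\<^sup>*" unfolding Q_def by (rule set_rev_mp[OF _ rtrancl_mono]) auto
    then have "(a, s) \<in> Q\<^sup>*" by (auto simp: Q_def intro: rtrancl_into_rtrancl)
    then obtain X where X: "X \<in> dcycles Q" "(s, a) \<in> X"
      using closed_walk_dcycle[of s a Q] by (auto simp: Q_def)
    obtain y where y: "(y, s) \<in> X" using dcycles_in[OF X(1), of s] X(2) by (auto simp: Field_def)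
    then have "y = z" using a(1) dcyclesD[OF X(1)] by (auto simp: Q_def N_def)
    then show ?thesis
      using X y a z dcycles_mono[OF X(1), of R] by (auto simp: Q_def N_def)
  qed
  \<comment> \<open>Allowing a subrelation \<open>M\<close> covers both \<open>R\<close> itself and
    \<open>R\<close> without the candidate arc \<open>(s, a)\<close>.\<close>
  have start: "\<exists>a. (s, a) \<in> M \<inter> N \<and> (a, t) \<in> N\<^sup>*" if "(s, t) \<in> M\<^sup>*" "M \<subseteq> R" for M
  proof -
    have "(s, t) \<in> (M - UNIV \<times> {s})\<^sup>*" using that(1) by (rule rtrancl_no_return)
    then obtain a where a: "(s, a) \<in> M - UNIV \<times> {s}" "(a, t) \<in> (M - UNIV \<times> {s})\<^sup>*"
      using \<open>s \<noteq> t\<close> by (auto elim: converse_rtranclE)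
    have "M - UNIV \<times> {s} \<subseteq> N" using that(2) by (auto simp: N_def)
    then show ?thesis using a that(2) rtrancl_mono by blast
  qed
  obtain a where a: "(s, a) \<in> N" "(a, t) \<in> N\<^sup>*" using start[OF st(1)] by auto
  have "(s, t) \<notin> (R - {(s, a)})\<^sup>*"
  proof
    assume "(s, t) \<in> (R - {(s, a)})\<^sup>*"
    then obtain b where b: "(s, b) \<in> N" "(b, t) \<in> N\<^sup>*" "b \<noteq> a" using start by blast
    obtain X Y where "X \<in> dcycles R" "Y \<in> dcycles R" "(s, a) \<in> X" "(z, s) \<in> X" "(s, b) \<in> Y" "(z, s) \<in> Y"
      using first a b by meson
    then show False using uniq[OF _ _ _ _ h, of X Y] dcycles_out_unique[of X R s a b] b(3) by blast
  qed
  then show ?thesis using a by (auto simp: N_def)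
qed

section \<open>Three-colourings\<close>

lemma mod3_cases: "a mod 3 = 0 \<or> a mod 3 = 1 \<or> a mod 3 = 2" for a :: int
  using pos_mod_bound[of 3 a] pos_mod_sign[of 3 a] by linarith

lemma succ_mod3: "(a + 1) mod 3 = (if a mod 3 = 2 then 0 else a mod 3 + 1)" for a :: int
  using mod3_cases[of a] mod_add_left_eq[of a 3 1] by (elim disjE) simp_all

lemma mod3_neq: "a mod 3 \<noteq> b mod 3 \<longleftrightarrow> b mod 3 = (a + 1) mod 3 \<or> a mod 3 = (b + 1) mod 3" for a b :: int
  using mod3_cases[of a] mod3_cases[of b] unfolding succ_mod3 by (elim disjE) simp_all

lemma mod3_asym: "b mod 3 = (a + 1) mod 3 \<Longrightarrow> a mod 3 \<noteq> (b + 1) mod 3" for a b :: int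
  using mod3_cases[of a] mod3_cases[of b] unfolding succ_mod3 by (elim disjE) simp_all

lemma mod3_succ_neq: "(a + 1) mod 3 \<noteq> a mod 3" for a :: int
  using mod3_cases[of a] unfolding succ_mod3 by (elim disjE) simp_all

lemma mod3_minus: "(- b) mod 3 = (- a + 1) mod 3 \<longleftrightarrow> a mod 3 = (b + 1) mod 3" for a b :: int
  by (simp add: mod_eq_dvd_iff algebra_simps)

lemma mod3_succ_inj: "(a + 1) mod 3 = (b + 1) mod 3 \<longleftrightarrow> a mod 3 = b mod 3" for a b :: int
  by (simp add: mod_eq_dvd_iff)

definition undirected :: "('a \<times> 'a) set \<Rightarrow> 'a set set" where
  "undirected X = (\<lambda>(x, y). {x, y}) ` X"

text \<open>Colours are arbitrary integers, compared modulo 3.\<close>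

definition coloring3 :: "'a set set \<Rightarrow> ('a \<Rightarrow> int) \<Rightarrow> bool" where
  "coloring3 F c \<longleftrightarrow> (\<forall>x y. {x, y} \<in> F \<longrightarrow> c x mod 3 \<noteq> c y mod 3)"

definition arcs :: "'a set set \<Rightarrow> ('a \<Rightarrow> int) \<Rightarrow> ('a \<times> 'a) set" where
  "arcs F c = {(x, y). {x, y} \<in> F \<and> c y mod 3 = (c x + 1) mod 3}"

definition shift :: "'a set \<Rightarrow> ('a \<Rightarrow> int) \<Rightarrow> 'a \<Rightarrow> int" where
  "shift S c x = (if x \<in> S then c x + 1 else c x)"

lemma coloring3_insert:
  assumes "coloring3 (F - {{u, v}}) c" "c u mod 3 \<noteq> c v mod 3"
  shows "coloring3 F c"
  unfolding coloring3_def
proof (intro allI impI)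
  fix x y assume "{x, y} \<in> F"
  then show "c x mod 3 \<noteq> c y mod 3"
    using assms by (cases "{x, y} = {u, v}") (auto simp: coloring3_def doubleton_eq_iff)
qed

lemma arcs_edge: "(x, y) \<in> arcs F c \<Longrightarrow> {x, y} \<in> F"
  by (simp add: arcs_def)

lemma arcs_total:
  assumes "coloring3 F c" "{x, y} \<in> F" shows "(x, y) \<in> arcs F c \<or> (y, x) \<in> arcs F c"
proof -
  have "c x mod 3 \<noteq> c y mod 3" using assms by (auto simp: coloring3_def)
  then have "c y mod 3 = (c x + 1) mod 3 \<or> c x mod 3 = (c y + 1) mod 3" by (simp only: mod3_neq)
  then show ?thesis using assms(2) by (auto simp: arcs_def insert_commute)
qed

lemma arcs_antisym:
  assumes "(x, y) \<in> arcs F c" shows "(y, x) \<notin> arcs F c"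
proof -
  have "c y mod 3 = (c x + 1) mod 3" using assms by (simp add: arcs_def)
  then have "c x mod 3 \<noteq> (c y + 1) mod 3" by (rule mod3_asym)
  then show ?thesis by (simp add: arcs_def)
qed

lemma arcs_neq: "(x, y) \<in> arcs F c \<Longrightarrow> x \<noteq> y"
  using arcs_antisym by metis

lemma coloring3_uminus: "coloring3 F c \<Longrightarrow> coloring3 F (\<lambda>x. - c x)"
  unfolding coloring3_def by (simp add: mod_eq_dvd_iff dvd_diff_commute)

text \<open>Negating the colours reverses the digraph. This is the duality by which facts about
  outgoing arcs are later used for incoming ones.\<close>

lemma arcs_uminus: "arcs F (\<lambda>x. - c x) = (arcs F c)\<inverse>"
proof -
  show ?thesis by (simp only: arcs_def mod3_minus) (auto simp: insert_commute)
qed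

text \<open>Only an edge whose end outside \<open>S\<close> is one colour ahead could become
  monochromatic, and such an edge is an arc leaving \<open>S\<close>. Arcs entering \<open>S\<close>
  are merely reversed.\<close>

lemma coloring3_shift:
  assumes "coloring3 F c" and "\<And>x y. x \<in> S \<Longrightarrow> y \<notin> S \<Longrightarrow> (x, y) \<notin> arcs F c"
  shows "coloring3 F (shift S c)"
proof -
  have *: "shift S c x mod 3 \<noteq> shift S c y mod 3" if "x \<in> S" "y \<notin> S" "{x, y} \<in> F" for x y
    using assms(2)[OF that(1,2)] that unfolding arcs_def shift_def by auto
  have "shift S c x mod 3 \<noteq> shift S c y mod 3" if xy: "{x, y} \<in> F" for x y
  proof (cases "x \<in> S \<longleftrightarrow> y \<in> S")
    case True
    have "c x mod 3 \<noteq> c y mod 3" using assms(1) xy by (auto simp: coloring3_def)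
    then have "(c x + 1) mod 3 \<noteq> (c y + 1) mod 3" by (simp only: mod3_succ_inj not_False_eq_True)
    with \<open>c x mod 3 \<noteq> c y mod 3\<close> True show ?thesis by (simp add: shift_def)
  next
    case False
    then show ?thesis using *[of x y] *[of y x] xy by (metis insert_commute)
  qed
  then show ?thesis by (simp add: coloring3_def)
qed

lemma undirected_mem:
  assumes "X \<subseteq> arcs F c" "(x, y) \<in> arcs F c"
  shows "{x, y} \<in> undirected X \<longleftrightarrow> (x, y) \<in> X"
proof
  assume "{x, y} \<in> undirected X"
  then obtain a b where ab: "(a, b) \<in> X" "{x, y} = {a, b}" by (auto simp: undirected_def)
  then have "(a, b) = (x, y)" using arcs_antisym[OF assms(2)] assms(1) by (auto simp: doubleton_eq_iff)
  then show "(x, y) \<in> X" using ab by simp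
qed (force simp: undirected_def)

lemma undirected_memI: "(x, y) \<in> X \<Longrightarrow> {x, y} \<in> undirected X"
  by (force simp: undirected_def)

text \<open>No two arcs are antiparallel, so different directed cycles give different zero cycles.
  The counting arguments below rest on this.\<close>

lemma undirected_inj:
  assumes "X \<subseteq> arcs F c" "Y \<subseteq> arcs F c" "undirected X = undirected Y"
  shows "X = Y"
proof -
  have "(x, y) \<in> X \<longleftrightarrow> (x, y) \<in> Y" for x y
    using undirected_mem[OF assms(1)] undirected_mem[OF assms(2)] assms by blast
  then show ?thesis by auto
qed

lemma undirected_subset: "X \<subseteq> arcs F c \<Longrightarrow> undirected X \<subseteq> F"
  by (auto simp: undirected_def dest: arcs_edge)

lemma Union_undirected: "\<Union> (undirected X) = Field X"
  by (force simp: undirected_def Field_def)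

lemma undirected_converse: "undirected (X\<inverse>) = undirected X"
  by (force simp: undirected_def insert_commute)

text \<open>The colour rises by one modulo 3 with each step.\<close>

lemma periodic_arcs_dvd:
  assumes "periodic n p" "steps p \<subseteq> arcs F c" "c (p i) mod 3 = c (p j) mod 3"
  shows "3 dvd i - j"
proof -
  have step: "c (p (i + 1)) mod 3 = (c (p i) + 1) mod 3" for i
    using assms(2) by (auto simp: steps_def arcs_def)
  have up: "c (p (j + k)) mod 3 = (c (p j) + k) mod 3" if "0 \<le> k" for j k
    using that
  proof (induction k rule: int_ge_induct)
    case (step k)
    have "c (p (j + (k + 1))) mod 3 = (c (p (j + k)) + 1) mod 3"
      using \<open>\<And>i. c (p (i + 1)) mod 3 = (c (p i) + 1) mod 3\<close>[of "j + k"] by (simp add: add.assoc)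
    also have "\<dots> = (c (p j) + k + 1) mod 3" using step.IH by (metis mod_add_left_eq)
    finally show ?case by (simp add: add.assoc)
  qed simp
  show ?thesis
  proof (cases "j \<le> i")
    case True
    then have "3 dvd c (p i) - (c (p j) + (i - j))" using up[of "i - j" j] by (simp add: mod_eq_dvd_iff)
    from dvd_diff[OF assms(3)[unfolded mod_eq_dvd_iff] this] show ?thesis by simp
  next
    case False
    then have "3 dvd c (p j) - (c (p i) + (j - i))" using up[of "j - i" i] by (simp add: mod_eq_dvd_iff)
    from dvd_add[OF assms(3)[unfolded mod_eq_dvd_iff] this] show ?thesis by simp
  qed
qed

text \<open>A full period returns to the starting colour, so its length is a multiple of 3.\<close>

lemma dcycle_cycle:
  assumes "X \<in> dcycles (arcs F c)"
  shows "undirected X \<in> cycles F" "3 dvd card (undirected X)" "card X \<ge> 3"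
proof -
  obtain n p where p: "periodic n p" and X: "X = steps p" and R: "X \<subseteq> arcs F c"
    using assms by (auto simp: dcycles_def)
  have n: "0 < n" using p by (simp add: periodic_def)
  have pn: "p n = p 0" using p by (simp add: periodic_def)
  then have dvd: "3 dvd n" using periodic_arcs_dvd[of n p F c n 0] p R X by simp
  define xs where "xs = map (\<lambda>i. p (int i)) [0..<nat n]"
  have len: "length xs = nat n" by (simp add: xs_def)
  have len3: "3 \<le> length xs" using dvd n zdvd_imp_le[OF dvd n] by (simp add: len)
  have "inj_on (\<lambda>i. p (int i)) {0..<nat n}"
    using p by (auto simp: inj_on_def periodic_def)
  then have dist: "distinct xs" by (simp add: xs_def distinct_map)
  have nxt: "xs ! (Suc i mod length xs) = p (int i + 1)" if "i < nat n" for i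
  proof -
    have "Suc i mod nat n < nat n" using n by simp
    then have "xs ! (Suc i mod length xs) = p (int (Suc i mod nat n))" by (simp add: xs_def)
    also have "int (Suc i mod nat n) = (int i + 1) mod n" using n by (simp add: zmod_int add.commute)
    also have "p \<dots> = p (int i + 1)" using p by (simp add: periodic_def)
    finally show ?thesis .
  qed
  have "cycle_edges xs = (\<lambda>i. {xs ! i, xs ! (Suc i mod length xs)}) ` {..<nat n}"
    by (auto simp: cycle_edges_def len)
  also have "\<dots> = (\<lambda>i. {p (int i), p (int i + 1)}) ` {..<nat n}"
    using nxt by (intro image_cong) (auto simp: xs_def)
  also have "\<dots> = undirected X"
  proof
    show "undirected X \<subseteq> (\<lambda>i. {p (int i), p (int i + 1)}) ` {..<nat n}"
    proof
      fix e assume "e \<in> undirected X"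
      then obtain i where e: "e = {p i, p (i + 1)}" by (auto simp: undirected_def X steps_def)
      have "p i = p (i mod n)" "p (i + 1) = p (i mod n + 1)"
        using p by (auto simp: periodic_def mod_add_left_eq)
      then have "e = {p (int (nat (i mod n))), p (int (nat (i mod n)) + 1)}" using e n by simp
      moreover have "nat (i mod n) < nat n" using n by simp
      ultimately show "e \<in> (\<lambda>i. {p (int i), p (int i + 1)}) ` {..<nat n}" by blast
    qed
  qed (auto simp: undirected_def X steps_def)
  finally have xs: "cycle_edges xs = undirected X" .
  show "undirected X \<in> cycles F"
    using undirected_subset[OF R] dist len3 xs unfolding cycles_def by blast
  show "3 dvd card (undirected X)"
    using card_cycle_edges[OF dist len3] xs len dvd n by (metis int_dvd_int_iff int_nat_eq less_imp_le of_nat_numeral)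
  have "card (undirected X) \<ge> 3"
    using card_cycle_edges[OF dist len3] xs len3 by simp
  moreover have "finite (undirected X)" using calculation card.infinite by fastforce
  moreover have "inj_on (\<lambda>(x, y). {x, y}) X"
    using R arcs_antisym by (fastforce simp: inj_on_def doubleton_eq_iff)
  ultimately show "card X \<ge> 3" by (simp add: undirected_def card_image)
qed

section \<open>Zero cycles in 4-critical graphs\<close>

definition zero_cycles :: "'a set set \<Rightarrow> 'a set set set" where
  "zero_cycles E = {C \<in> cycles E. 3 dvd card C}"

text \<open>What the argument needs from 4-criticality, restated with integer colourings modulo 3.
  The last assumption reflects that an isolated vertex could be deleted without lowering the
  chromatic number.\<close>

locale critical4 =
  fixes V :: "'a set" and E :: "'a set set"
  assumes finite_V: "finite V"
    and edges: "{x, y} \<in> E \<Longrightarrow> x \<in> V \<and> y \<in> V \<and> x \<noteq> y"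
    and edge_pair: "e \<in> E \<Longrightarrow> \<exists>x y. e = {x, y}"
    and not_colorable: "\<not> coloring3 E c"
    and critical: "e \<in> E \<Longrightarrow> \<exists>c. coloring3 (E - {e}) c"
    and not_isolated: "x \<in> V \<Longrightarrow> \<exists>y. {x, y} \<in> E"
begin

abbreviation ZC where "ZC \<equiv> zero_cycles E"

abbreviation del :: "'a \<Rightarrow> 'a \<Rightarrow> ('a \<Rightarrow> int) \<Rightarrow> ('a \<times> 'a) set" where
  "del u v c \<equiv> arcs (E - {{u, v}}) c"

lemma finite_E: "finite E"
proof -
  have "E \<subseteq> Pow V" using edges edge_pair by fastforce
  then show ?thesis using finite_V finite_subset by blast
qed

lemma ZC_edges: "C \<in> ZC \<Longrightarrow> C \<subseteq> E"
  by (simp add: zero_cycles_def cycles_def)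

lemma finite_ZC: "finite ZC"
  by (rule finite_subset[of _ "Pow E"]) (use ZC_edges finite_E in auto)

lemma dcycle_ZC:
  assumes "X \<in> dcycles (del u v c)"
  shows "undirected X \<in> ZC" "{u, v} \<notin> undirected X"
  using dcycle_cycle[OF assms] undirected_subset[OF dcyclesD[OF assms]]
  by (auto simp: zero_cycles_def cycles_def)

section \<open>Exchanging the missing edge\<close>

lemma ends_same:
  assumes "{u, v} \<in> E" "coloring3 (E - {{u, v}}) c"
  shows "c u mod 3 = c v mod 3"
  using coloring3_insert[OF assms(2)] not_colorable by blast

text \<open>Otherwise shifting everything reachable from \<open>u\<close> would separate the colours
  of \<open>u\<close> and \<open>v\<close>, and the missing edge could be put back.\<close>

lemma reach:
  assumes "{u, v} \<in> E" "coloring3 (E - {{u, v}}) c"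
  shows "(u, v) \<in> (del u v c)\<^sup>*"
proof (rule ccontr)
  assume no: "(u, v) \<notin> (del u v c)\<^sup>*"
  define S where "S = (del u v c)\<^sup>* `` {u}"
  have "coloring3 (E - {{u, v}}) (shift S c)"
    using assms(2) by (rule coloring3_shift) (auto simp: S_def intro: rtrancl_into_rtrancl)
  from ends_same[OF assms(1) this] have "(c u + 1) mod 3 = c v mod 3"
    using no by (simp add: S_def shift_def)
  with ends_same[OF assms] show False using mod3_succ_neq by metis
qed

lemma reach_back:
  assumes "{u, v} \<in> E" "coloring3 (E - {{u, v}}) c"
  shows "(v, u) \<in> (del u v c)\<^sup>*"
  using reach[of v u c] assms by (simp add: insert_commute)

text \<open>The set \<open>S\<close> reachable from \<open>u\<close> without \<open>(x, y)\<close>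
  is left by no arc but \<open>(x, y)\<close>. Shifting \<open>S\<close> therefore allows
  \<open>{u, v}\<close> to be restored at the expense of \<open>{x, y}\<close>. Old walks from
  \<open>u\<close> to \<open>x\<close> stay inside \<open>S\<close>, old walks from \<open>y\<close>
  to \<open>v\<close> stay outside, so both survive; the new arc \<open>(v, u)\<close> and a new
  walk from \<open>x\<close> to \<open>y\<close> join them into one strong component.\<close>

lemma cut:
  assumes e: "{u, v} \<in> E" and c: "coloring3 (E - {{u, v}}) c"
    and f: "(x, y) \<in> del u v c" and no: "(u, v) \<notin> (del u v c - {(x, y)})\<^sup>*"
  shows "\<exists>c'. coloring3 (E - {{x, y}}) c' \<and>
    (\<exists>Z \<in> dcycles (del x y c'). (v, u) \<in> Z) \<and>
    (\<forall>p q. (p, q) \<in> del u v c - {(x, y)} \<longrightarrow>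
      (u, p) \<in> (del u v c - {(x, y)})\<^sup>* \<and> (q, x) \<in> (del u v c - {(x, y)})\<^sup>* \<or>
      (y, p) \<in> (del u v c - {(x, y)})\<^sup>* \<and> (q, v) \<in> (del u v c - {(x, y)})\<^sup>* \<longrightarrow>
      (\<exists>Z \<in> dcycles (del x y c'). (p, q) \<in> Z))"
proof -
  define R where "R = del u v c"
  define Q where "Q = R - {(x, y)}"
  define S where "S = Q\<^sup>* `` {u}"
  define c' where "c' = shift S c"
  have RQ: "R = insert (x, y) Q" using f by (auto simp: Q_def R_def)
  have xy: "{x, y} \<in> E" "{x, y} \<noteq> {u, v}" using arcs_edge[OF f] by auto
  have "(u, v) \<in> R\<^sup>*" "(u, v) \<notin> Q\<^sup>*"
    using reach[OF e c] no by (auto simp: R_def Q_def)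
  then have ux: "(u, x) \<in> Q\<^sup>*" and yv: "(y, v) \<in> Q\<^sup>*"
    unfolding RQ rtrancl_insert by auto
  have uS: "u \<in> S" and vS: "v \<notin> S" using no by (auto simp: S_def Q_def R_def)
  have closed: "b \<in> S" if "a \<in> S" "(a, b) \<in> Q" for a b
    using that by (auto simp: S_def intro: rtrancl_into_rtrancl)
  have notS: "z \<notin> S" if "(z, v) \<in> Q\<^sup>*" for z
    using that vS by (auto simp: S_def dest: rtrancl_trans)
  \<comment> \<open>After the shift \<open>u\<close> is one colour ahead of \<open>v\<close>, so the
    restored edge becomes the arc \<open>(v, u)\<close>.\<close>
  have uv': "c' u mod 3 = (c' v + 1) mod 3"
    using ends_same[OF e c] uS vS by (simp add: c'_def shift_def mod3_succ_inj)
  have "coloring3 (E - {{u, v}, {x, y}}) c'"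
    unfolding c'_def
  proof (rule coloring3_shift)
    show "coloring3 (E - {{u, v}, {x, y}}) c" using c by (auto simp: coloring3_def)
    fix a b assume "a \<in> S" "b \<notin> S"
    then have "(a, b) \<notin> Q" using closed by blast
    then show "(a, b) \<notin> arcs (E - {{u, v}, {x, y}}) c" by (auto simp: Q_def R_def arcs_def)
  qed
  moreover have "E - {{u, v}, {x, y}} = E - {{x, y}} - {{u, v}}" by auto
  moreover have "c' u mod 3 \<noteq> c' v mod 3" using uv' mod3_succ_neq[of "c' v"] by simp
  ultimately have c': "coloring3 (E - {{x, y}}) c'"
    using coloring3_insert by metis
  define R' where "R' = del x y c'"
  have vu: "(v, u) \<in> R'"
    using uv' e xy(2) by (auto simp: R'_def arcs_def insert_commute)
  have edge: "{p, q} \<in> E - {{x, y}}" if "(p, q) \<in> Q" for p q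
  proof -
    have pq: "(p, q) \<in> del u v c" "(p, q) \<noteq> (x, y)" using that by (auto simp: Q_def R_def)
    then have "{p, q} \<noteq> {x, y}" using arcs_antisym[OF f] by (auto simp: doubleton_eq_iff)
    then show ?thesis using arcs_edge[OF pq(1)] by simp
  qed
  have keep: "(p, q) \<in> R'" if "(p, q) \<in> Q" "p \<in> S \<longleftrightarrow> q \<in> S" for p q
  proof -
    have "c q mod 3 = (c p + 1) mod 3" using that(1) by (simp add: Q_def R_def arcs_def)
    moreover from this have "(c q + 1) mod 3 = (c p + 1 + 1) mod 3" by (metis mod_add_left_eq)
    ultimately show ?thesis
      using edge[OF that(1)] that(2) by (simp add: R'_def arcs_def c'_def shift_def)
  qed
  have into_S: "(z, p) \<in> R'\<^sup>*" if "(z, p) \<in> Q\<^sup>*" "z \<in> S" for z p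
  proof -
    from that(1) have "(z, p) \<in> R'\<^sup>* \<and> p \<in> S"
    proof (induction rule: rtrancl_induct)
      case (step a b)
      then show ?case using keep[of a b] closed by (blast intro: rtrancl_into_rtrancl)
    qed (use that in simp)
    then show ?thesis ..
  qed
  \<comment> \<open>A walk that still leads to \<open>v\<close> cannot touch \<open>S\<close>, since
    otherwise \<open>v\<close> would belong to \<open>S\<close>.\<close>
  have outside: "(z, p) \<in> R'\<^sup>*" if "(z, p) \<in> Q\<^sup>*" "(p, v) \<in> Q\<^sup>*" for z p
    using that(1)
  proof (induction rule: converse_rtrancl_induct)
    case (step a b)
    have "(b, v) \<in> Q\<^sup>*" using step(2) that(2) by (rule rtrancl_trans)
    moreover from step(1) this have "(a, v) \<in> Q\<^sup>*" by (rule converse_rtrancl_into_rtrancl)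
    ultimately have "(a, b) \<in> R'" using notS step(1) keep by blast
    then show ?case using step(3) by (rule converse_rtrancl_into_rtrancl)
  qed simp
  \<comment> \<open>This is \<open>reach\<close> for the new missing edge; it links the two
    surviving parts.\<close>
  have xy': "(x, y) \<in> R'\<^sup>*" using reach[OF xy(1) c'] by (simp add: R'_def)
  have yv': "(y, v) \<in> R'\<^sup>*" using outside[OF yv] by simp
  have ux': "(u, x) \<in> R'\<^sup>*" using into_S[OF ux uS] .
  have xu': "(x, u) \<in> R'\<^sup>*"
    using rtrancl_trans[OF rtrancl_trans[OF xy' yv'] r_into_rtrancl[OF vu]] .
  have vx': "(v, x) \<in> R'\<^sup>*" using vu ux' by (rule converse_rtrancl_into_rtrancl)
  have st: "\<exists>Z \<in> dcycles R'. (p, q) \<in> Z" if "(p, q) \<in> R'" "(x, p) \<in> R'\<^sup>*" "(q, x) \<in> R'\<^sup>*" for p q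
    by (rule closed_walk_dcycle[OF that(1) rtrancl_trans[OF that(3,2)]])
  have 1: "\<exists>Z \<in> dcycles R'. (v, u) \<in> Z"
    by (rule st[OF vu rtrancl_trans[OF xy' yv'] ux'])
  have 2: "\<exists>Z \<in> dcycles R'. (p, q) \<in> Z" if pq: "(p, q) \<in> Q" "(u, p) \<in> Q\<^sup>*" "(q, x) \<in> Q\<^sup>*" for p q
  proof (rule st)
    have p: "p \<in> S" using pq(2) by (simp add: S_def)
    then have q: "q \<in> S" using pq(1) closed by blast
    show "(p, q) \<in> R'" using keep pq(1) p q by blast
    show "(x, p) \<in> R'\<^sup>*" by (rule rtrancl_trans[OF xu' into_S[OF pq(2) uS]])
    show "(q, x) \<in> R'\<^sup>*" by (rule into_S[OF pq(3) q])
  qed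
  have 3: "\<exists>Z \<in> dcycles R'. (p, q) \<in> Z" if pq: "(p, q) \<in> Q" "(y, p) \<in> Q\<^sup>*" "(q, v) \<in> Q\<^sup>*" for p q
  proof (rule st)
    have pv: "(p, v) \<in> Q\<^sup>*" using pq(1,3) by (rule converse_rtrancl_into_rtrancl)
    show "(p, q) \<in> R'" using keep pq notS pv by blast
    show "(x, p) \<in> R'\<^sup>*" by (rule rtrancl_trans[OF xy' outside[OF pq(2) pv]])
    show "(q, x) \<in> R'\<^sup>*" by (rule rtrancl_trans[OF outside[OF pq(3)] vx']) simp
  qed
  show ?thesis
    unfolding Q_def[symmetric] R_def[symmetric]
    by (intro exI[of _ c'] conjI c' 1[unfolded R'_def] allI impI)
      (elim disjE conjE; rule 2[unfolded R'_def] 3[unfolded R'_def]; assumption)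
qed

end

section \<open>Auxiliary facts on walks and periodic sequences\<close>

lemma strong_converse: "strong (R\<inverse>) u = (strong R u)\<inverse>"
  unfolding strong_def rtrancl_converse by blast

lemma strong_base:
  assumes "(u, v) \<in> R\<^sup>*" "(v, u) \<in> R\<^sup>*" shows "strong R v = strong R u"
proof -
  have "(u, x) \<in> R\<^sup>* \<longleftrightarrow> (v, x) \<in> R\<^sup>*" "(x, u) \<in> R\<^sup>* \<longleftrightarrow> (x, v) \<in> R\<^sup>*" for x
    using assms by (meson rtrancl_trans)+
  then show ?thesis by (simp add: strong_def)
qed

lemma rtrancl_delete:
  assumes "(s, t) \<in> R\<^sup>*" "(s, t) \<notin> (R - {(x, y)})\<^sup>*"
  shows "(s, x) \<in> (R - {(x, y)})\<^sup>*" "(y, t) \<in> (R - {(x, y)})\<^sup>*"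
proof -
  have "R \<subseteq> insert (x, y) (R - {(x, y)})" by blast
  then have "(s, t) \<in> (insert (x, y) (R - {(x, y)}))\<^sup>*" using assms(1) rtrancl_mono by blast
  then show "(s, x) \<in> (R - {(x, y)})\<^sup>*" "(y, t) \<in> (R - {(x, y)})\<^sup>*"
    using assms(2) unfolding rtrancl_insert by auto
qed

text \<open>A walk uses only arcs that are reachable from its start and lead on to its end. These
  are the arcs to which the last conclusion of \<open>cut\<close> applies.\<close>

lemma rtrancl_between:
  assumes "(a, v) \<in> R\<^sup>*"
  shows "(a, v) \<in> {(p, q) \<in> R. (a, p) \<in> R\<^sup>* \<and> (q, v) \<in> R\<^sup>*}\<^sup>*"
proof -
  let ?P = "{(p, q) \<in> R. (a, p) \<in> R\<^sup>* \<and> (q, v) \<in> R\<^sup>*}"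
  have "(w, v) \<in> R\<^sup>* \<longrightarrow> (a, w) \<in> ?P\<^sup>*" if "(a, w) \<in> R\<^sup>*" for w
    using that
  proof (induction rule: rtrancl_induct)
    case (step y z)
    show ?case
    proof
      assume z: "(z, v) \<in> R\<^sup>*"
      with step(2) have "(y, v) \<in> R\<^sup>*" by (rule converse_rtrancl_into_rtrancl)
      then have "(a, y) \<in> ?P\<^sup>*" using step(3) by blast
      moreover have "(y, z) \<in> ?P" using step(1,2) z by blast
      ultimately show "(a, z) \<in> ?P\<^sup>*" by (rule rtrancl_into_rtrancl)
    qed
  qed simp
  then show ?thesis using assms by blast
qed

lemma periodic_eqD: "periodic n p \<Longrightarrow> p i = p j \<Longrightarrow> 0 \<le> i \<Longrightarrow> i < n \<Longrightarrow> 0 \<le> j \<Longrightarrow> j < n \<Longrightarrow> i = j"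
  by (simp add: periodic_def)

lemma periodic_add: "periodic n p \<Longrightarrow> p (i + n) = p i"
  by (simp add: periodic_def)

lemma periodic_range:
  assumes "periodic n p" "x \<in> range p"
  shows "\<exists>i. 0 \<le> i \<and> i < n \<and> x = p i"
proof -
  obtain i where "x = p i" using assms(2) by blast
  then show ?thesis using assms(1) by (intro exI[of _ "i mod n"]) (simp add: periodic_def)
qed

lemma Field_steps: "Field (steps p) = range p"
proof -
  have "p i \<in> Field (steps p)" for i using stepsI[of p i] by (auto simp: Field_def)
  then show ?thesis by (auto simp: Field_def steps_def)
qed

section \<open>Minimum degree and zero cycles with a common edge\<close>

context critical4
begin

text \<open>The first arc of a walk from \<open>x\<close> to \<open>y\<close> lies in the strong
  component, because \<open>y\<close> reaches \<open>x\<close> in turn.\<close>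

lemma through_vertex:
  assumes "{x, y} \<in> E" "coloring3 (E - {{x, y}}) c"
  shows "\<exists>X \<in> dcycles (del x y c). x \<in> Field X \<and> X \<subseteq> strong (del x y c) x"
proof -
  have "x \<noteq> y" using edges[OF assms(1)] by blast
  then obtain a where a: "(x, a) \<in> del x y c" "(a, y) \<in> (del x y c)\<^sup>*"
    using reach[OF assms] by (auto elim: converse_rtranclE)
  have "(a, x) \<in> (del x y c)\<^sup>*" using a(2) reach_back[OF assms] by (rule rtrancl_trans)
  then have "(x, a) \<in> strong (del x y c) x" using a(1) by (simp add: strong_def)
  then obtain X where "X \<in> dcycles (del x y c)" "(x, a) \<in> X" "X \<subseteq> strong (del x y c) x"
    using strong_dcycle by metis
  then show ?thesis unfolding Field_def by blast
qed

text \<open>Besides \<open>y\<close>, the vertex \<open>x\<close> has a successor and a predecessor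
  on a directed cycle of the graph without \<open>{x, y}\<close>; these differ because arcs are
  never antiparallel.\<close>

lemma degree3:
  assumes "x \<in> V" shows "3 \<le> card {y. {x, y} \<in> E}"
proof -
  obtain y where y: "{x, y} \<in> E" using not_isolated assms by blast
  obtain c where c: "coloring3 (E - {{x, y}}) c" using critical[OF y] by blast
  obtain X where X: "X \<in> dcycles (del x y c)" "x \<in> Field X" using through_vertex[OF y c] by blast
  obtain a b where ab: "(x, a) \<in> X" "(b, x) \<in> X" using dcycles_out[OF X] dcycles_in[OF X] by blast
  then have del: "(x, a) \<in> del x y c" "(b, x) \<in> del x y c" using dcyclesD[OF X(1)] by blast+
  then have "{x, a} \<in> E - {{x, y}}" "{x, b} \<in> E - {{x, y}}" using arcs_edge by (metis insert_commute)+
  moreover have "a \<noteq> b" using del arcs_antisym by metis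
  moreover have "y \<noteq> a" "y \<noteq> b" using calculation by blast+
  ultimately have "card {y, a, b} = 3" "{y, a, b} \<subseteq> {y. {x, y} \<in> E}" using y by simp_all
  moreover have "finite {y. {x, y} \<in> E}"
    by (rule finite_subset[OF _ finite_V]) (use edges in blast)
  ultimately show ?thesis using card_mono by metis
qed

lemma E_nonempty: "\<exists>u v. {u, v} \<in> E"
proof (rule ccontr)
  assume "\<not> ?thesis"
  then have "coloring3 E (\<lambda>_. 0)" by (simp add: coloring3_def)
  then show False using not_colorable by blast
qed

text \<open>If zero cycles were edge-disjoint, one arc \<open>(u, a)\<close> would cut
  \<open>u\<close> from \<open>v\<close> and one arc \<open>(z, u)\<close> would cut
  \<open>v\<close> from \<open>u\<close>. A directed cycle \<open>A\<close> through both has a third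
  arc, on a walk from \<open>a\<close> to \<open>v\<close> or from \<open>v\<close> to
  \<open>z\<close>. Exchanging \<open>{u, v}\<close> for \<open>{u, a}\<close> or
  \<open>{z, u}\<close> puts this third arc on a zero cycle that avoids the exchanged edge, hence is
  not \<open>A\<close> but shares an edge with it.\<close>

lemma zero_cycles_share_edge: "\<exists>C \<in> ZC. \<exists>D \<in> ZC. C \<noteq> D \<and> C \<inter> D \<noteq> {}"
proof (rule ccontr)
  assume "\<not> ?thesis"
  then have disj: "C = D" if "C \<in> ZC" "D \<in> ZC" "e \<in> C" "e \<in> D" for C D e using that by blast
  obtain u v where e: "{u, v} \<in> E" using E_nonempty by blast
  obtain c where c: "coloring3 (E - {{u, v}}) c" using critical[OF e] by blast
  define R where "R = del u v c"
  have uv: "(u, v) \<in> R\<^sup>*" "(v, u) \<in> R\<^sup>*" "u \<noteq> v"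
    using reach[OF e c] reach_back[OF e c] edges[OF e] by (auto simp: R_def)
  have uniq: "X = Y" if "X \<in> dcycles R" "Y \<in> dcycles R" "h \<in> X" "h \<in> Y" for X Y h
  proof -
    have "undirected X = undirected Y"
      using that dcycle_ZC(1) disj[of "undirected X" "undirected Y" "case h of (x, y) \<Rightarrow> {x, y}"]
      by (cases h) (auto simp: R_def intro: undirected_memI)
    then show ?thesis using that undirected_inj dcyclesD unfolding R_def by metis
  qed
  have "\<exists>a. (u, a) \<in> R \<and> (u, v) \<notin> (R - {(u, a)})\<^sup>*"
    by (rule unique_dcycles_cut[OF _ uv]) (use uniq in blast)
  then obtain a where f: "(u, a) \<in> R" "(u, v) \<notin> (R - {(u, a)})\<^sup>*" by blast
  have "\<exists>z. (u, z) \<in> R\<inverse> \<and> (u, v) \<notin> (R\<inverse> - {(u, z)})\<^sup>*"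
  proof (rule unique_dcycles_cut)
    show "(u, v) \<in> (R\<inverse>)\<^sup>*" "(v, u) \<in> (R\<inverse>)\<^sup>*" "u \<noteq> v" using uv by (auto simp: rtrancl_converse)
    fix X Y h assume "X \<in> dcycles (R\<inverse>)" "Y \<in> dcycles (R\<inverse>)" "h \<in> X" "h \<in> Y"
    then have "X\<inverse> = Y\<inverse>" using uniq[of "X\<inverse>" "Y\<inverse>" "prod.swap h"] dcycles_converse
      by (metis converse_converse converse_iff prod.collapse swap_simp)
    then show "X = Y" by simp
  qed
  then obtain z where z: "(z, u) \<in> R" "(u, v) \<notin> (R\<inverse> - {(u, z)})\<^sup>*" by blast
  have "R\<inverse> - {(u, z)} = (R - {(z, u)})\<inverse>" by auto
  then have h: "(v, u) \<notin> (R - {(z, u)})\<^sup>*" using z(2) by (simp add: rtrancl_converse)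
  obtain c1 where c1: "\<And>p q. (p, q) \<in> R - {(u, a)} \<Longrightarrow> (a, p) \<in> (R - {(u, a)})\<^sup>* \<Longrightarrow> (q, v) \<in> (R - {(u, a)})\<^sup>* \<Longrightarrow>
      \<exists>Z \<in> dcycles (del u a c1). (p, q) \<in> Z"
    using cut[OF e c, of u a] f unfolding R_def by blast
  have Rvu: "R = del v u c" by (simp add: R_def insert_commute)
  have "{v, u} \<in> E" "coloring3 (E - {{v, u}}) c" using e c by (simp_all add: insert_commute)
  from cut[OF this, of z u] z(1) h obtain c2 where
    c2: "\<And>p q. (p, q) \<in> R - {(z, u)} \<Longrightarrow> (v, p) \<in> (R - {(z, u)})\<^sup>* \<Longrightarrow> (q, z) \<in> (R - {(z, u)})\<^sup>* \<Longrightarrow>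
      \<exists>Z \<in> dcycles (del z u c2). (p, q) \<in> Z"
    unfolding Rvu by blast
  define P1 where "P1 = {(p, q) \<in> R - {(u, a)}. (a, p) \<in> (R - {(u, a)})\<^sup>* \<and> (q, v) \<in> (R - {(u, a)})\<^sup>*}"
  define P2 where "P2 = {(p, q) \<in> R - {(z, u)}. (v, p) \<in> (R - {(z, u)})\<^sup>* \<and> (q, z) \<in> (R - {(z, u)})\<^sup>*}"
  define Q where "Q = {(u, a), (z, u)} \<union> P1 \<union> P2"
  have "(a, v) \<in> (R - {(u, a)})\<^sup>*" by (rule rtrancl_delete(2)[OF uv(1) f(2)])
  then have "(a, v) \<in> P1\<^sup>*" unfolding P1_def by (rule rtrancl_between)
  then have av: "(a, v) \<in> Q\<^sup>*" by (rule set_rev_mp[OF _ rtrancl_mono]) (auto simp: Q_def)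
  have "(v, z) \<in> (R - {(z, u)})\<^sup>*" by (rule rtrancl_delete(1)[OF uv(2) h])
  then have "(v, z) \<in> P2\<^sup>*" unfolding P2_def by (rule rtrancl_between)
  then have "(v, z) \<in> Q\<^sup>*" by (rule set_rev_mp[OF _ rtrancl_mono]) (auto simp: Q_def)
  with av have "(a, z) \<in> Q\<^sup>*" by (rule rtrancl_trans)
  moreover have "(z, u) \<in> Q" by (simp add: Q_def)
  ultimately have "(a, u) \<in> Q\<^sup>*" by (rule rtrancl_into_rtrancl)
  moreover have "(u, a) \<in> Q" by (simp add: Q_def)
  ultimately obtain A where A: "A \<in> dcycles Q" "(u, a) \<in> A" using closed_walk_dcycle by metis
  have "Q \<subseteq> R" using f z by (auto simp: Q_def P1_def P2_def)
  with A(1) have AR: "A \<in> dcycles R" by (rule dcycles_mono)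
  have "u \<in> Field A" using A(2) by (auto simp: Field_def)
  then obtain b where b: "(b, u) \<in> A" using dcycles_in[OF A(1)] by blast
  \<comment> \<open>An arc of \<open>P1\<close> into \<open>u\<close> would give a walk from
    \<open>u\<close> to \<open>v\<close> avoiding \<open>(u, a)\<close>; an arc of \<open>P2\<close>
    into \<open>u\<close> would give one from \<open>v\<close> to \<open>u\<close> avoiding
    \<open>(z, u)\<close>.\<close>
  have "b = z"
  proof (rule ccontr)
    assume "b \<noteq> z"
    moreover have "u \<noteq> a" using arcs_neq[OF f(1)[unfolded R_def]] .
    moreover have "(b, u) \<in> Q" using b dcyclesD[OF A(1)] by (rule rev_subsetD)
    ultimately have "(b, u) \<in> P1 \<or> (b, u) \<in> P2" unfolding Q_def by blast
    then show False
    proof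
      assume "(b, u) \<in> P1"
      then show False using f(2) unfolding P1_def by blast
    next
      assume "(b, u) \<in> P2"
      then have "(v, b) \<in> (R - {(z, u)})\<^sup>*" "(b, u) \<in> R - {(z, u)}" unfolding P2_def by blast+
      then show False using h by (meson rtrancl_into_rtrancl)
    qed
  qed
  with b have hA: "(z, u) \<in> A" by simp
  have "\<not> A \<subseteq> {(u, a), (z, u)}"
    using dcycle_cycle(3)[OF AR[unfolded R_def]] card_mono[of "{(u, a), (z, u)}" A] by (auto simp: card_insert_if split: if_splits)
  then obtain p q where g: "(p, q) \<in> A" "(p, q) \<noteq> (u, a)" "(p, q) \<noteq> (z, u)" by auto
  moreover have "(p, q) \<in> Q" using g(1) dcyclesD[OF A(1)] by (rule rev_subsetD)
  ultimately have "(p, q) \<in> P1 \<or> (p, q) \<in> P2" unfolding Q_def by blast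
  then show False
  proof
    assume "(p, q) \<in> P1"
    then obtain Z where Z: "Z \<in> dcycles (del u a c1)" "(p, q) \<in> Z" using c1 unfolding P1_def by blast
    then have "undirected Z = undirected A"
      using disj dcycle_ZC(1) AR g(1) undirected_memI unfolding R_def by metis
    then show False using dcycle_ZC(2)[OF Z(1)] A(2) undirected_memI by metis
  next
    assume "(p, q) \<in> P2"
    then obtain Z where Z: "Z \<in> dcycles (del z u c2)" "(p, q) \<in> Z" using c2 unfolding P2_def by blast
    then have "undirected Z = undirected A"
      using disj dcycle_ZC(1) AR g(1) undirected_memI unfolding R_def by metis
    then show False using dcycle_ZC(2)[OF Z(1)] hA undirected_memI by metis
  qed
qed

section \<open>Strong components that are a single cycle\<close>

text \<open>Here the strong component of the removed edge is a single cycle \<open>p\<close> without further incoming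
  arcs. Recolouring all vertices except \<open>p 1, \<dots>, p l\<close> trades the missing edge for \<open>{p 0, p 1}\<close>,
  and the path from \<open>p 0\<close> to \<open>p 1\<close> that criticality then provides has to avoid the cycle.\<close>

lemma bypass_source:
  assumes e: "{p 0, p l} \<in> E" and c: "coloring3 (E - {{p 0, p l}}) c"
    and per: "periodic n p" and sub: "steps p \<subseteq> del (p 0) (p l) c"
    and source: "\<And>a b. (a, b) \<in> del (p 0) (p l) c \<Longrightarrow> b \<in> range p \<Longrightarrow> (a, b) \<in> steps p"
    and l: "0 < l" "l < n"
  shows "\<exists>Z \<in> ZC. \<forall>j. 0 \<le> j \<longrightarrow> j < n \<longrightarrow> {p j, p (j + 1)} \<in> Z \<longleftrightarrow> 1 \<le> j \<and> j < l"
proof -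
  define R where "R = del (p 0) (p l) c"
  define T where "T = p ` {1..l}"
  define d where "d = shift (- T) c"
  define R3 where "R3 = del (p 0) (p 1) d"
  have inj: "i = j" if "p i = p j" "0 \<le> i" "i < n" "0 \<le> j" "j < n" for i j
    using periodic_eqD[OF per] that by blast
  have arc: "(p i, p (i + 1)) \<in> R" for i using sub stepsI unfolding R_def by blast
  have edge: "{p i, p (i + 1)} \<in> E - {{p 0, p l}}" for i
    using arcs_edge[OF arc[of i, unfolded R_def]] .
  have f: "{p 0, p 1} \<in> E" "{p 0, p 1} \<noteq> {p 0, p l}" using edge[of 0] by auto
  have p0T: "p 0 \<notin> T" using inj l by (fastforce simp: T_def)
  have T1: "p 1 \<in> T" and Tl: "p l \<in> T" using l by (auto simp: T_def)
  \<comment> \<open>By \<open>source\<close>, the cycle itself is the only way into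
    \<open>T\<close>. From outside it is entered only by the arc \<open>(p 0, p 1)\<close>, the edge
    about to be removed.\<close>
  have pred: "\<exists>k. 1 \<le> k \<and> k \<le> l \<and> a = p (k - 1) \<and> b = p k" if ab: "(a, b) \<in> R" "b \<in> T" for a b
  proof -
    have "b \<in> range p" using ab(2) by (auto simp: T_def)
    then have "(a, b) \<in> steps p" using source ab(1) unfolding R_def by blast
    then obtain i where i: "a = p i" "b = p (i + 1)" by (auto simp: steps_def)
    obtain k where k: "1 \<le> k" "k \<le> l" "b = p k" using ab(2) by (auto simp: T_def)
    have "(i + 1) mod n = k mod n" using i k per by (simp add: periodic_def)
    then have "i mod n = (k - 1) mod n" by (simp add: mod_eq_dvd_iff algebra_simps)
    then have "a = p (k - 1)" using i per by (simp add: periodic_def)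
    then show ?thesis using k by blast
  qed
  have "coloring3 (E - {{p 0, p 1}} - {{p 0, p l}}) d"
    unfolding d_def
  proof (rule coloring3_shift)
    show "coloring3 (E - {{p 0, p 1}} - {{p 0, p l}}) c" using c by (simp add: coloring3_def)
    fix a b assume ab: "a \<in> - T" "b \<notin> - T"
    show "(a, b) \<notin> arcs (E - {{p 0, p 1}} - {{p 0, p l}}) c"
    proof
      assume arc': "(a, b) \<in> arcs (E - {{p 0, p 1}} - {{p 0, p l}}) c"
      then have "(a, b) \<in> R" by (simp add: arcs_def R_def)
      then obtain k where k: "1 \<le> k" "k \<le> l" "a = p (k - 1)" "b = p k" using pred ab by blast
      have "k = 1" using k ab(1) by (force simp: T_def)
      then show False using k arcs_edge[OF arc'] by simp
    qed
  qed
  moreover have ends: "d (p 0) mod 3 = (d (p l) + 1) mod 3"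
    using ends_same[OF e c] p0T Tl by (simp add: d_def shift_def mod3_succ_inj)
  then have "d (p 0) mod 3 \<noteq> d (p l) mod 3" using mod3_succ_neq[of "d (p l)"] by simp
  ultimately have d: "coloring3 (E - {{p 0, p 1}}) d" by (rule coloring3_insert)
  have arc_back: "(p l, p 0) \<in> R3"
    using e f ends by (auto simp: R3_def arcs_def insert_commute)
  \<comment> \<open>After the shift all remaining edges between \<open>T\<close> and the rest point
    into \<open>T\<close>, except the restored one, which points from \<open>p l\<close> to
    \<open>p 0\<close>.\<close>
  have leave: "a = p l \<and> b = p 0" if ab: "(a, b) \<in> R3" "a \<in> T" "b \<notin> T" for a b
  proof (cases "{a, b} = {p 0, p l}")
    case True
    then show ?thesis using ab p0T Tl by (auto simp: doubleton_eq_iff)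
  next
    case False
    have "{a, b} \<in> E - {{p 0, p l}}" using arcs_edge[OF ab(1)[unfolded R3_def]] False by simp
    then have "c a mod 3 \<noteq> c b mod 3" using c by (simp add: coloring3_def)
    moreover have "(c b + 1) mod 3 = (c a + 1) mod 3"
      using ab by (simp add: R3_def arcs_def d_def shift_def)
    ultimately show ?thesis by (simp add: mod3_succ_inj)
  qed
  have same: "(a, b) \<in> R3 \<longleftrightarrow> (a, b) \<in> R" if ab: "a \<in> T \<longleftrightarrow> b \<in> T" for a b
  proof -
    have "{a, b} \<noteq> {p 0, p l}" "{a, b} \<noteq> {p 0, p 1}" using ab p0T Tl T1 by (auto simp: doubleton_eq_iff)
    moreover have "d b mod 3 = (d a + 1) mod 3 \<longleftrightarrow> c b mod 3 = (c a + 1) mod 3"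
      using ab by (simp add: d_def shift_def mod3_succ_inj[of "c b" "c a + 1", simplified])
    ultimately show ?thesis by (simp add: R3_def R_def arcs_def)
  qed
  define N where "N = R3 \<inter> (- T) \<times> (- T)"
  define M where "M = N\<^sup>* `` {p 0}"
  have M0: "p 0 \<in> M" by (simp add: M_def)
  have Mstep: "b \<in> M" if "a \<in> M" "(a, b) \<in> N" for a b
    using that by (auto simp: M_def intro: rtrancl_into_rtrancl)
  have M: "z \<notin> T \<and> (z = p 0 \<or> z \<notin> range p)" if "z \<in> M" for z
  proof -
    have "(p 0, z) \<in> N\<^sup>*" using that by (simp add: M_def)
    then show ?thesis
    proof (induction rule: rtrancl_induct)
      case base
      show ?case using p0T by simp
    next
      case (step y z)
      have yz: "(y, z) \<in> R" "y \<notin> T" "z \<notin> T" using step(2) same unfolding N_def by auto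
      have "z \<notin> range p"
      proof
        assume "z \<in> range p"
        then have "(y, z) \<in> steps p" using source yz(1) unfolding R_def by blast
        then obtain i where i: "y = p i" "z = p (i + 1)" by (auto simp: steps_def)
        then have "p i = p 0" using step(3) by auto
        then have "p (i + 1) = p (0 + 1)"
          using per unfolding periodic_def by (metis mod_add_cong)
        then show False using i yz(3) T1 by simp
      qed
      then show ?case using yz(3) by simp
    qed
  qed
  \<comment> \<open>Otherwise a walk from \<open>p 0\<close> enters \<open>T\<close> beyond
    \<open>p 1\<close>. Inside \<open>T\<close> it can only move towards \<open>p l\<close>, and
    from there only back to \<open>p 0\<close>, so it never reaches \<open>p 1\<close>.\<close>
  have "\<exists>a \<in> M. (a, p 1) \<in> R3"
  proof (rule ccontr)
    assume no: "\<not> ?thesis"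
    have "z \<in> M \<or> (z \<in> T \<and> z \<noteq> p 1)" if "(p 0, z) \<in> R3\<^sup>*" for z
      using that
    proof (induction rule: rtrancl_induct)
      case base
      then show ?case using M0 by simp
    next
      case (step y z)
      show ?case
      proof (cases "y \<in> T")
        case True
        then have y: "y \<noteq> p 1" using step(3) M by auto
        show ?thesis
        proof (cases "z \<in> T")
          case zT: True
          then obtain k where k: "1 \<le> k" "k \<le> l" "y = p (k - 1)" "z = p k"
            using pred same step(2) True by blast
          have "k \<noteq> 1" using k True p0T by auto
          then have "z \<noteq> p 1" using k inj[of k 1] l by auto
          then show ?thesis using zT by simp
        next
          case False
          then show ?thesis using leave[OF step(2) True] M0 by simp
        qed
      next
        case False
        then have yM: "y \<in> M" using step(3) by blast
        show ?thesis
        proof (cases "z \<in> T")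
          case True
          then show ?thesis using no yM step(2) by blast
        next
          case zT: False
          then have "(y, z) \<in> N" using step(2) False by (simp add: N_def)
          then show ?thesis using Mstep[OF yM] by simp
        qed
      qed
    qed
    from this[OF reach[OF f(1) d, folded R3_def]] show False using M T1 by blast
  qed
  then obtain a where a: "a \<in> M" "(a, p 1) \<in> R3" by blast
  have "a \<noteq> p 0" using arcs_edge[OF a(2)[unfolded R3_def]] by auto
  then have a_range: "a \<notin> range p" using M[OF a(1)] by blast
  \<comment> \<open>The closed walk goes from \<open>p 0\<close> through \<open>M\<close> to
    \<open>a\<close>, then to \<open>p 1\<close>, along the cycle to \<open>p l\<close>, and back to
    \<open>p 0\<close>.\<close>
  define Q where "Q = {(a, p 1), (p l, p 0)} \<union> {(p i, p (i + 1)) | i. 1 \<le> i \<and> i < l} \<union> (R3 \<inter> M \<times> M)"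
  have inner: "(p i, p (i + 1)) \<in> R3" if "1 \<le> i" "i < l" for i
    using same[of "p i" "p (i + 1)"] arc[of i] that by (auto simp: T_def)
  have QR: "Q \<subseteq> R3" using a arc_back inner by (auto simp: Q_def)
  have "(p 0, z) \<in> (R3 \<inter> M \<times> M)\<^sup>*" if "(p 0, z) \<in> N\<^sup>*" for z
    using that
  proof (induction rule: rtrancl_induct)
    case (step y z)
    have "y \<in> M" using step(1) by (simp add: M_def)
    then have "(y, z) \<in> R3 \<inter> M \<times> M" using Mstep step(2) by (auto simp: N_def)
    with step(3) show ?case by (rule rtrancl_into_rtrancl)
  qed simp
  then have "(p 0, a) \<in> (R3 \<inter> M \<times> M)\<^sup>*" using a(1) by (simp add: M_def)
  then have 1: "(p 0, a) \<in> Q\<^sup>*" by (rule set_rev_mp[OF _ rtrancl_mono]) (unfold Q_def, blast)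
  have "(p 1, p (1 + (l - 1))) \<in> Q\<^sup>*" by (rule steps_walk) (use l in \<open>auto simp: Q_def\<close>)
  then have 2: "(p 1, p l) \<in> Q\<^sup>*" by simp
  have "(a, p 1) \<in> Q" by (simp add: Q_def)
  from rtrancl_trans[OF rtrancl_into_rtrancl[OF 1 this] 2] have "(p 0, p l) \<in> Q\<^sup>*" .
  moreover have "(p l, p 0) \<in> Q" by (simp add: Q_def)
  ultimately obtain Z where Z: "Z \<in> dcycles Q" "(p l, p 0) \<in> Z" using closed_walk_dcycle by metis
  \<comment> \<open>In \<open>Q\<close> each of \<open>p 2, ..., p l\<close> can be entered only
    from its predecessor on the cycle, so \<open>Z\<close>, traced backwards from
    \<open>p l\<close>, contains the whole path from \<open>p 1\<close>.\<close>
  have inQ: "\<alpha> = p (k - 1)" if k: "2 \<le> k" "k \<le> l" and q: "(\<alpha>, p k) \<in> Q" for \<alpha> k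
  proof -
    have "p k \<noteq> p 1" "p k \<noteq> p 0" using inj[of k 1] inj[of k 0] k l by auto
    moreover from this have "p k \<notin> M" using M by blast
    ultimately obtain i where i: "\<alpha> = p i" "p k = p (i + 1)" "1 \<le> i" "i < l" using q by (auto simp: Q_def)
    then have "k = i + 1" using inj[of k "i + 1"] k l by simp
    then show ?thesis using i by simp
  qed
  have desc: "int m \<le> l - 1 \<Longrightarrow> p (l - int m) \<in> Field Z" for m
  proof (induction m)
    case 0
    then show ?case using Z(2) by (auto simp: Field_def)
  next
    case (Suc m)
    then have "p (l - int m) \<in> Field Z" by simp
    then obtain b where b: "(b, p (l - int m)) \<in> Z" using dcycles_in[OF Z(1)] by blast
    then have "b = p (l - int m - 1)"
      using inQ[of "l - int m" b] dcyclesD[OF Z(1)] Suc.prems by auto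
    then show ?case using b by (auto simp: Field_def algebra_simps)
  qed
  have Zin: "(p i, p (i + 1)) \<in> Z" if "1 \<le> i" "i < l" for i
  proof -
    have "p (i + 1) \<in> Field Z" using desc[of "nat (l - i - 1)"] that by simp
    then obtain b where b: "(b, p (i + 1)) \<in> Z" using dcycles_in[OF Z(1)] by blast
    then have "b = p i" using inQ[of "i + 1" b] dcyclesD[OF Z(1)] that by auto
    then show ?thesis using b by simp
  qed
  \<comment> \<open>Since \<open>M\<close> meets the cycle only in \<open>p 0\<close> and
    \<open>a\<close> is off the cycle, the only other arc of \<open>Q\<close> with both ends on it
    is \<open>(p l, p 0)\<close>, whose edge is not a cycle edge.\<close>
  have Zout: "1 \<le> j \<and> j < l" if jZ: "{p j, p (j + 1)} \<in> undirected Z" and j: "0 \<le> j" "j < n" for j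
  proof -
    obtain \<alpha> \<beta> where ab: "(\<alpha>, \<beta>) \<in> Z" "{p j, p (j + 1)} = {\<alpha>, \<beta>}"
      using jZ by (auto simp: undirected_def)
    then have q: "(\<alpha>, \<beta>) \<in> Q" using dcyclesD[OF Z(1)] by blast
    have neq: "\<alpha> \<noteq> \<beta>" using subsetD[OF QR q] unfolding R3_def by (rule arcs_neq)
    have "\<alpha> \<in> {p j, p (j + 1)}" "\<beta> \<in> {p j, p (j + 1)}" unfolding ab(2) by simp_all
    then have "\<alpha> \<in> range p" "\<beta> \<in> range p" by auto
    then have "\<not> (\<alpha> \<in> M \<and> \<beta> \<in> M)" "\<alpha> \<noteq> a"
      using M[of \<alpha>] M[of \<beta>] neq a_range by metis+
    moreover have "(\<alpha>, \<beta>) \<noteq> (p l, p 0)"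
    proof
      assume "(\<alpha>, \<beta>) = (p l, p 0)"
      then have "{p j, p (j + 1)} = {p 0, p l}" using ab(2) by (simp add: insert_commute)
      then show False using edge[of j] by simp
    qed
    ultimately obtain i where i: "\<alpha> = p i" "\<beta> = p (i + 1)" "1 \<le> i" "i < l" using q by (auto simp: Q_def)
    have "(p (j + 1), p j) \<noteq> (p i, p (i + 1))"
      using arcs_antisym[OF arc[of j, unfolded R_def]] arc[of i, unfolded R_def] by auto
    then have "p j = p i" using ab(2) by (auto simp: i doubleton_eq_iff)
    then have "j = i" using inj[of j i] i l j by simp
    then show ?thesis using i by simp
  qed
  have "undirected Z \<in> ZC"
    using dcycles_mono[OF Z(1) QR] unfolding R3_def by (rule dcycle_ZC(1))
  moreover have "{p j, p (j + 1)} \<in> undirected Z \<longleftrightarrow> 1 \<le> j \<and> j < l" if "0 \<le> j" "j < n" for j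
  proof
    assume "{p j, p (j + 1)} \<in> undirected Z"
    then show "1 \<le> j \<and> j < l" using that by (rule Zout)
  next
    assume "1 \<le> j \<and> j < l"
    then show "{p j, p (j + 1)} \<in> undirected Z" using undirected_memI[OF Zin[of j]] by simp
  qed
  ultimately show ?thesis by blast
qed

text \<open>Shifting everything reachable from \<open>p 0\<close> reverses the arcs that enter this
  set. The component then has no incoming arcs from elsewhere, as \<open>bypass_source\<close>
  requires.\<close>

lemma bypass:
  assumes e: "{p 0, p l} \<in> E" and c: "coloring3 (E - {{p 0, p l}}) c"
    and per: "periodic n p" and st: "strong (del (p 0) (p l) c) (p 0) = steps p"
    and l: "0 < l" "l < n"
  shows "\<exists>Z \<in> ZC. \<forall>j. 0 \<le> j \<longrightarrow> j < n \<longrightarrow> {p j, p (j + 1)} \<in> Z \<longleftrightarrow> 1 \<le> j \<and> j < l"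
proof -
  define R where "R = del (p 0) (p l) c"
  define S where "S = R\<^sup>* `` {p 0}"
  define d where "d = shift S c"
  have p: "(p i, p (i + 1)) \<in> R" "(p 0, p i) \<in> R\<^sup>*" "(p (i + 1), p 0) \<in> R\<^sup>*" for i
    using stepsI[of p i] st unfolding R_def strong_def by blast+
  have d: "coloring3 (E - {{p 0, p l}}) d"
    unfolding d_def using c
    by (rule coloring3_shift) (auto simp: S_def R_def intro: rtrancl_into_rtrancl)
  have into: "a \<in> S \<and> (a, b) \<in> R" if ab: "(a, b) \<in> del (p 0) (p l) d" "b \<in> S" for a b
  proof (cases "a \<in> S")
    case True
    then show ?thesis
      using ab mod3_succ_inj[of "c b" "c a + 1"] by (simp add: R_def arcs_def d_def shift_def)
  next
    case False
    have "{a, b} \<in> E - {{p 0, p l}}" using arcs_edge[OF ab(1)] .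
    then have "c a mod 3 \<noteq> c b mod 3" using c by (simp add: coloring3_def)
    moreover have "(c b + 1) mod 3 = (c a + 1) mod 3"
      using ab False by (simp add: arcs_def d_def shift_def)
    ultimately show ?thesis by (simp add: mod3_succ_inj)
  qed
  have pS: "p i \<in> S" for i using p(2) by (simp add: S_def)
  have "steps p \<subseteq> del (p 0) (p l) d"
  proof
    fix x assume "x \<in> steps p"
    then obtain i where x: "x = (p i, p (i + 1))" by (auto simp: steps_def)
    show "x \<in> del (p 0) (p l) d"
      using p(1)[of i] pS[of i] pS[of "i + 1"] mod3_succ_inj[of "c (p (i + 1))" "c (p i) + 1"]
      by (simp add: x R_def arcs_def d_def shift_def)
  qed
  moreover have "(a, b) \<in> steps p" if arc: "(a, b) \<in> del (p 0) (p l) d" and b: "b \<in> range p" for a b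
  proof -
    obtain i where i: "b = p i" using b by blast
    have "a \<in> S" and ab: "(a, b) \<in> R" using into[OF arc] i pS by auto
    then have "(p 0, a) \<in> R\<^sup>*" by (simp add: S_def)
    moreover have "(b, p 0) \<in> R\<^sup>*" using p(3)[of "i - 1"] i by simp
    ultimately have "(a, b) \<in> strong R (p 0)" using ab by (simp add: strong_def)
    then show ?thesis using st by (simp add: R_def)
  qed
  ultimately show ?thesis using bypass_source[OF e d per _ _ l] by blast
qed

text \<open>A single directed cycle would be the whole strong component, with \<open>u\<close> and
  \<open>v\<close> on it. Applying \<open>bypass\<close> to both paths between them, in both
  directions, gives four zero cycles besides the cycle itself.\<close>

lemma two_dcycles:
  assumes e: "{u, v} \<in> E" and c: "coloring3 (E - {{u, v}}) c" and few: "card ZC \<le> 4"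
  shows "\<exists>X \<in> dcycles (del u v c). \<exists>Y \<in> dcycles (del u v c).
    X \<noteq> Y \<and> X \<subseteq> strong (del u v c) u \<and> Y \<subseteq> strong (del u v c) u"
proof (rule ccontr)
  define R where "R = del u v c"
  assume "\<not> ?thesis"
  then have single: "X = Y" if "X \<in> dcycles R" "Y \<in> dcycles R" "X \<subseteq> strong R u" "Y \<subseteq> strong R u" for X Y
    using that unfolding R_def by blast
  obtain X where X: "X \<in> dcycles R" "u \<in> Field X" "X \<subseteq> strong R u"
    using through_vertex[OF e c] unfolding R_def by blast
  have strong: "strong R u = X"
  proof
    show "strong R u \<subseteq> X"
    proof
      fix x assume "x \<in> strong R u"
      then obtain Y where "Y \<in> dcycles R" "x \<in> Y" "Y \<subseteq> strong R u" using strong_dcycle by (metis prod.collapse)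
      then show "x \<in> X" using single X by metis
    qed
  qed (rule X(3))
  have uv: "(u, v) \<in> R\<^sup>*" "(v, u) \<in> R\<^sup>*" "u \<noteq> v"
    using reach[OF e c] reach_back[OF e c] edges[OF e] by (auto simp: R_def)
  obtain z where z: "(u, z) \<in> R\<^sup>*" "(z, v) \<in> R" using uv(1,3) by (auto elim: rtranclE)
  have "(z, v) \<in> strong R u" using z uv(2) by (simp add: strong_def)
  then have vX: "v \<in> Field X" unfolding strong by (auto simp: Field_def)
  obtain n q where q: "periodic n q" "X = steps q" using X(1) by (auto simp: dcycles_def)
  obtain k where k: "u = q k" using X(2) unfolding q(2) Field_steps by blast
  define p where "p i = q (k + i)" for i
  have per: "periodic n p" and Xp: "X = steps p"
    using periodic_shift[OF q(1)] steps_shift[of q k] q(2) unfolding p_def[abs_def] by auto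
  have p0: "p 0 = u" using k by (simp add: p_def)
  have "v \<in> range p" using vX unfolding Xp Field_steps .
  then obtain l where l: "0 \<le> l" "l < n" "v = p l" using periodic_range[OF per] by blast
  have "l \<noteq> 0" using l p0 uv(3) by auto
  then have l0: "0 < l" using l by simp
  have pn: "p (n + i) = p i" for i using periodic_add[OF per, of i] by (simp add: add.commute)
  have subR: "steps p \<subseteq> R" using X(1) Xp dcyclesD by blast
  \<comment> \<open>Equal colours of \<open>u\<close> and \<open>v\<close> force at least three
    edges on either path, which leaves room to tell the five cycles apart.\<close>
  have c0l: "c (p 0) mod 3 = c (p l) mod 3" using ends_same[OF e c] p0 l by simp
  have "3 dvd l - 0" by (rule periodic_arcs_dvd[OF per subR[unfolded R_def]]) (use c0l in simp)
  then have l3: "3 \<le> l" using l0 zdvd_imp_le by fastforce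
  have "3 dvd n - l" by (rule periodic_arcs_dvd[OF per subR[unfolded R_def]]) (use c0l pn[of 0] in simp)
  then have n3: "3 \<le> n - l" using l(2) zdvd_imp_le by fastforce
  have e': "{v, u} \<in> E" and c': "coloring3 (E - {{v, u}}) c" and R': "del v u c = R"
    using e c by (simp_all add: insert_commute R_def)
  have strong_v: "strong R v = steps p" using strong_base[OF uv(1,2)] strong Xp by simp
  have strong_u: "strong R u = steps p" using strong Xp by simp
  let ?nc = "\<lambda>x. - c x"
  have Rm: "del u v ?nc = R\<inverse>" "del v u ?nc = R\<inverse>" using arcs_uminus R' unfolding R_def by metis+
  have neg: "coloring3 (E - {{u, v}}) ?nc" "coloring3 (E - {{v, u}}) ?nc"
    using coloring3_uminus c c' by blast+
  obtain Z1 where Z1: "Z1 \<in> ZC" "\<And>j. 0 \<le> j \<Longrightarrow> j < n \<Longrightarrow> {p j, p (j + 1)} \<in> Z1 \<longleftrightarrow> 1 \<le> j \<and> j < l"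
    using bypass[of p l c n] e c per strong_u l0 l p0 unfolding R_def by metis
  have "\<exists>Z \<in> ZC. \<forall>j. 0 \<le> j \<longrightarrow> j < n \<longrightarrow> {p (l - j), p (l - (j + 1))} \<in> Z \<longleftrightarrow> 1 \<le> j \<and> j < l"
    by (rule bypass[of "\<lambda>i. p (l - i)" l ?nc n, OF _ _ periodic_reflect[OF per]])
      (use e' neg strong_v l0 l p0 Rm in \<open>simp_all add: strong_converse steps_reflect\<close>)
  then obtain Z2 where Z2: "Z2 \<in> ZC"
    "\<And>j. 0 \<le> j \<Longrightarrow> j < n \<Longrightarrow> {p (l - j), p (l - (j + 1))} \<in> Z2 \<longleftrightarrow> 1 \<le> j \<and> j < l" by blast
  have "\<exists>Z \<in> ZC. \<forall>j. 0 \<le> j \<longrightarrow> j < n \<longrightarrow> {p (l + j), p (l + (j + 1))} \<in> Z \<longleftrightarrow> 1 \<le> j \<and> j < n - l"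
    by (rule bypass[of "\<lambda>i. p (l + i)" "n - l" c n, OF _ _ periodic_shift[OF per]])
      (use e' c' strong_v l0 l p0 R' pn[of 0] in \<open>simp_all add: steps_shift\<close>)
  then obtain Z3 where Z3: "Z3 \<in> ZC"
    "\<And>j. 0 \<le> j \<Longrightarrow> j < n \<Longrightarrow> {p (l + j), p (l + (j + 1))} \<in> Z3 \<longleftrightarrow> 1 \<le> j \<and> j < n - l" by blast
  have "\<exists>Z \<in> ZC. \<forall>j. 0 \<le> j \<longrightarrow> j < n \<longrightarrow> {p (n - j), p (n - (j + 1))} \<in> Z \<longleftrightarrow> 1 \<le> j \<and> j < n - l"
    by (rule bypass[of "\<lambda>i. p (n - i)" "n - l" ?nc n, OF _ _ periodic_reflect[OF per]])
      (use e neg strong_u l0 l p0 Rm pn[of 0] in \<open>simp_all add: strong_converse steps_reflect\<close>)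
  then obtain Z4 where Z4: "Z4 \<in> ZC"
    "\<And>j. 0 \<le> j \<Longrightarrow> j < n \<Longrightarrow> {p (n - j), p (n - (j + 1))} \<in> Z4 \<longleftrightarrow> 1 \<le> j \<and> j < n - l" by blast
  define Z where "Z = undirected X"
  have Z: "Z \<in> ZC" using dcycle_ZC(1) X(1) unfolding R_def Z_def by blast
  have inZ: "{p i, p (i + 1)} \<in> Z" for i
    unfolding Z_def Xp by (rule undirected_memI[OF stepsI])
  \<comment> \<open>Of the cycle edges, \<open>Z1\<close> and \<open>Z2\<close> contain the path
    from \<open>p 0\<close> to \<open>p l\<close> without its first and its last edge respectively;
    \<open>Z3\<close> and \<open>Z4\<close> do the same for the path from \<open>p l\<close> back to
    \<open>p 0\<close>.\<close>
  have a0: "{p 0, p 1} \<notin> Z1" and a1: "{p 1, p 2} \<in> Z1" and al: "{p l, p (l + 1)} \<notin> Z1"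
    using Z1(2)[of 0] Z1(2)[of 1] Z1(2)[of l] l3 l by simp_all
  have b0: "{p 0, p 1} \<in> Z2" using Z2(2)[of "l - 1"] l3 l by (simp add: insert_commute)
  have "p (l - (n - 1)) = p (l + 1)" "p (l - n) = p l" using pn[of "l - n + 1"] pn[of "l - n"] by (simp_all add: algebra_simps)
  then have bl: "{p l, p (l + 1)} \<notin> Z2" using Z2(2)[of "n - 1"] l3 l by (simp add: insert_commute)
  have d0: "{p 0, p 1} \<notin> Z3" using Z3(2)[of "n - l"] pn[of 0] pn[of 1] l3 n3 by (simp add: algebra_simps)
  have "p (l + (n - l + 1)) = p 1" "p (l + (n - l + 1 + 1)) = p 2" using pn[of 1] pn[of 2] by (simp_all add: algebra_simps)
  then have d1: "{p 1, p 2} \<notin> Z3" using Z3(2)[of "n - l + 1"] l3 n3 by simp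
  have dl: "{p l, p (l + 1)} \<notin> Z3" using Z3(2)[of 0] l3 n3 by simp
  have f0: "{p 0, p 1} \<notin> Z4" using Z4(2)[of "n - 1"] l3 n3 by (simp add: insert_commute)
  have fl: "{p l, p (l + 1)} \<in> Z4" using Z4(2)[of "n - l - 1"] l3 n3 by (simp add: insert_commute algebra_simps)
  have "Z \<noteq> Z1" "Z \<noteq> Z2" "Z \<noteq> Z3" "Z \<noteq> Z4" using inZ[of 0] inZ[of l] a0 bl d0 f0 by auto
  moreover have "Z1 \<noteq> Z2" "Z1 \<noteq> Z3" "Z1 \<noteq> Z4" "Z2 \<noteq> Z3" "Z2 \<noteq> Z4" "Z3 \<noteq> Z4"
    using a0 a1 al b0 d0 d1 dl f0 fl by blast+
  ultimately have "card {Z, Z1, Z2, Z3, Z4} = 5" by simp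
  moreover have "card {Z, Z1, Z2, Z3, Z4} \<le> card ZC"
    by (rule card_mono[OF finite_ZC]) (use Z Z1(1) Z2(1) Z3(1) Z4(1) in blast)
  ultimately show False using few by simp
qed

end

section \<open>Four zero cycles\<close>

text \<open>The configuration forced by at most four zero cycles: two through the missing edge and
  two directed ones that avoid it. The facts \<open>reversed\<close>, \<open>swapped\<close> and
  \<open>ends_swapped\<close> provide its symmetries.\<close>

locale four_zero_cycles = critical4 +
  fixes u v :: 'a and c :: "'a \<Rightarrow> int" and A B :: "('a \<times> 'a) set" and C1 C2 :: "'a set set"
  assumes uv_edge: "{u, v} \<in> E" and col: "coloring3 (E - {{u, v}}) c"
    and A: "A \<in> dcycles (del u v c)" and B: "B \<in> dcycles (del u v c)" and AB: "A \<noteq> B"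
    and A_strong: "A \<subseteq> strong (del u v c) u" and B_strong: "B \<subseteq> strong (del u v c) u"
    and ZC_eq: "ZC = {undirected A, undirected B, C1, C2}" and C12: "C1 \<noteq> C2"
    and uv_C: "{u, v} \<in> C1" "{u, v} \<in> C2"
begin

abbreviation "R \<equiv> del u v c"

lemma AR: "A \<subseteq> R" and BR: "B \<subseteq> R"
  using A B dcyclesD by blast+

lemma ZC_cases:
  assumes "C \<in> ZC"
  shows "C = undirected A \<or> C = undirected B \<or> C = C1 \<or> C = C2"
  using assms unfolding ZC_eq by simp

lemma ZC_mem: "undirected A \<in> ZC" "undirected B \<in> ZC" "C1 \<in> ZC" "C2 \<in> ZC"
  unfolding ZC_eq by simp_all

lemma ZC_through:
  assumes "C \<in> ZC" "{u, v} \<in> C" shows "C = C1 \<or> C = C2"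
  using ZC_cases[OF assms(1)] assms(2) dcycle_ZC(2)[OF A] dcycle_ZC(2)[OF B] by metis

lemma ZC_avoid:
  assumes "C \<in> ZC" "{u, v} \<notin> C" shows "C = undirected A \<or> C = undirected B"
  using ZC_cases[OF assms(1)] assms(2) uv_C by metis

lemma undirected_AB: "undirected A \<noteq> undirected B"
  using AB undirected_inj[OF AR BR] by blast

lemma uv_not_AB: "{u, v} \<notin> undirected A" "{u, v} \<notin> undirected B"
  using dcycle_ZC(2) A B by blast+

lemma card_ZC: "card ZC = 4"
proof -
  have "undirected A \<noteq> C1" "undirected A \<noteq> C2" "undirected B \<noteq> C1" "undirected B \<noteq> C2"
    using uv_not_AB uv_C by auto
  then show ?thesis unfolding ZC_eq using undirected_AB C12 by simp
qed

lemma u_v: "(u, v) \<in> R\<^sup>*" "(v, u) \<in> R\<^sup>*" "u \<noteq> v"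
  using reach[OF uv_edge col] reach_back[OF uv_edge col] edges[OF uv_edge] by blast+

lemma reversed: "four_zero_cycles V E u v (\<lambda>x. - c x) (A\<inverse>) (B\<inverse>) C1 C2"
proof
  show "coloring3 (E - {{u, v}}) (\<lambda>x. - c x)" using col by (rule coloring3_uminus)
  show "A\<inverse> \<in> dcycles (del u v (\<lambda>x. - c x))" "B\<inverse> \<in> dcycles (del u v (\<lambda>x. - c x))"
    unfolding arcs_uminus using A B dcycles_converse by blast+
  show "A\<inverse> \<noteq> B\<inverse>" using AB by simp
  show "A\<inverse> \<subseteq> strong (del u v (\<lambda>x. - c x)) u" "B\<inverse> \<subseteq> strong (del u v (\<lambda>x. - c x)) u"
    unfolding arcs_uminus strong_converse using A_strong B_strong by simp_all
qed (use uv_edge ZC_eq C12 uv_C in \<open>simp_all add: undirected_converse\<close>)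

lemma swapped: "four_zero_cycles V E u v c B A C1 C2"
proof
  show "ZC = {undirected B, undirected A, C1, C2}" using ZC_eq by auto
qed (use uv_edge col A B AB A_strong B_strong C12 uv_C in simp_all)

lemma ends_swapped: "four_zero_cycles V E v u c A B C1 C2"
proof -
  have "del v u c = R" by (simp add: insert_commute)
  moreover have "strong R v = strong R u" using u_v by (intro strong_base)
  ultimately show ?thesis
    using uv_edge col A B AB A_strong B_strong ZC_eq C12 uv_C
    by unfold_locales (simp_all add: insert_commute)
qed

lemma dcycles_eq:
  assumes "X \<in> dcycles R" shows "X = A \<or> X = B"
proof -
  have "undirected X = undirected A \<or> undirected X = undirected B"
    using dcycle_ZC[OF assms] by (rule ZC_avoid)
  then show ?thesis
    using undirected_inj[OF dcyclesD[OF assms] AR] undirected_inj[OF dcyclesD[OF assms] BR] by blast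
qed

lemma strong_eq: "strong R u = A \<union> B"
proof
  show "strong R u \<subseteq> A \<union> B"
  proof
    fix x assume "x \<in> strong R u"
    then obtain X where "X \<in> dcycles R" "x \<in> X" using strong_dcycle by (metis prod.collapse)
    then show "x \<in> A \<union> B" using dcycles_eq by blast
  qed
qed (use A_strong B_strong in blast)

text \<open>Deleting \<open>g\<close> leaves two directed zero cycles that avoid \<open>g\<close>;
  with three through \<open>g\<close> there would be five.\<close>

lemma at_most_two:
  assumes g: "g \<in> E" and D: "D1 \<in> ZC" "D2 \<in> ZC" "D3 \<in> ZC" "g \<in> D1" "g \<in> D2" "g \<in> D3"
    and neq: "D1 \<noteq> D2" "D1 \<noteq> D3" "D2 \<noteq> D3"
  shows False
proof -
  obtain x y where xy: "g = {x, y}" using edge_pair[OF g] by blast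
  obtain c' where c': "coloring3 (E - {{x, y}}) c'" using critical g xy by blast
  obtain X Y where XY: "X \<in> dcycles (del x y c')" "Y \<in> dcycles (del x y c')" "X \<noteq> Y"
    using two_dcycles[OF _ c'] g xy card_ZC by auto
  have "undirected X \<noteq> undirected Y" using XY undirected_inj dcyclesD by metis
  moreover have not_in: "g \<notin> undirected X" "g \<notin> undirected Y" using XY dcycle_ZC(2) xy by blast+
  moreover from not_in have "undirected X \<noteq> D1" "undirected X \<noteq> D2" "undirected X \<noteq> D3"
    "undirected Y \<noteq> D1" "undirected Y \<noteq> D2" "undirected Y \<noteq> D3" using D(4-6) by auto
  ultimately have "card {undirected X, undirected Y, D1, D2, D3} = 5" using neq by simp
  moreover have "card {undirected X, undirected Y, D1, D2, D3} \<le> card ZC"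
    using D(1-3) XY dcycle_ZC(1) by (intro card_mono[OF finite_ZC]) blast
  ultimately show False using card_ZC by simp
qed

text \<open>The two directed cycles left after deleting the edge avoid it, so neither comes from
  \<open>A\<close> or \<open>B\<close>.\<close>

lemma AB_edge_pair:
  assumes "{x, y} \<in> E" "{x, y} \<in> undirected A" "{x, y} \<in> undirected B" and c': "coloring3 (E - {{x, y}}) c'"
  shows "\<exists>X1 \<in> dcycles (del x y c'). \<exists>X2 \<in> dcycles (del x y c'). undirected X1 = C1 \<and> undirected X2 = C2"
proof -
  obtain X Y where XY: "X \<in> dcycles (del x y c')" "Y \<in> dcycles (del x y c')" "X \<noteq> Y"
    using two_dcycles[OF assms(1) c'] card_ZC by auto
  have "undirected X \<noteq> undirected Y" using XY undirected_inj dcyclesD by metis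
  moreover have "undirected X \<in> ZC" "undirected Y \<in> ZC" "{x, y} \<notin> undirected X" "{x, y} \<notin> undirected Y"
    using XY dcycle_ZC by blast+
  ultimately have "undirected X = C1 \<and> undirected Y = C2 \<or> undirected X = C2 \<and> undirected Y = C1"
    using assms(2,3) ZC_cases[of "undirected X"] ZC_cases[of "undirected Y"] by metis
  then show ?thesis using XY by blast
qed

text \<open>At a branching vertex \<open>A\<close> and \<open>B\<close> part; with two such vertices
  \<open>dcycles_switch\<close> would produce a third directed cycle.\<close>

lemma branch_unique:
  assumes s: "(s, a) \<in> R" "(s, b) \<in> R" "a \<noteq> b" and t: "(t, d) \<in> R" "(t, e) \<in> R" "d \<noteq> e"
    and RAB: "R \<subseteq> A \<union> B"
  shows "s = t"
proof (rule ccontr)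
  assume "s \<noteq> t"
  have "\<exists>a b. (s, a) \<in> A \<and> (s, b) \<in> B \<and> a \<noteq> b" if "(s, a) \<in> R" "(s, b) \<in> R" "a \<noteq> b" for s a b
  proof -
    have "(s, a) \<in> A \<or> (s, a) \<in> B" "(s, b) \<in> A \<or> (s, b) \<in> B" using RAB that by blast+
    then show ?thesis using that(3) dcycles_out_unique[OF A] dcycles_out_unique[OF B] by metis
  qed
  from this[OF s] this[OF t] obtain a b d e
    where "(s, a) \<in> A" "(s, b) \<in> B" "a \<noteq> b" "(t, d) \<in> A" "(t, e) \<in> B" "d \<noteq> e" by blast
  from dcycles_switch[OF A B this \<open>s \<noteq> t\<close>] show False using dcycles_eq by blast
qed

text \<open>All arcs now lie on \<open>A\<close> or \<open>B\<close>, so at most one vertex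
  \<open>s\<close> has two outgoing and at most one vertex \<open>t\<close> two incoming arcs. Any
  vertex besides \<open>u\<close>, \<open>v\<close>, \<open>s\<close>, \<open>t\<close> would have
  degree at most 2. This leaves four vertices, all adjacent by \<open>degree3\<close>.\<close>

lemma spanning_complete:
  assumes span: "V \<subseteq> Field A \<union> Field B"
  shows "complete_graph 4 V E"
proof -
  interpret rev: four_zero_cycles V E u v "\<lambda>x. - c x" "A\<inverse>" "B\<inverse>" C1 C2 by (rule reversed)
  have K: "(u, x) \<in> R\<^sup>* \<and> (x, u) \<in> R\<^sup>*" if x: "x \<in> V" for x
  proof -
    obtain y where "(x, y) \<in> A \<or> (x, y) \<in> B"
      using span x dcycles_out[OF A, of x] dcycles_out[OF B, of x] by blast
    then have "(x, y) \<in> strong R u" using A_strong B_strong by blast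
    then have "(u, x) \<in> R\<^sup>*" "(x, y) \<in> R" "(y, u) \<in> R\<^sup>*" unfolding strong_def by blast+
    then show ?thesis by (meson converse_rtrancl_into_rtrancl)
  qed
  have RAB: "R \<subseteq> A \<union> B"
  proof (rule subrelI)
    fix x y assume xy: "(x, y) \<in> R"
    then have "x \<in> V" "y \<in> V" using arcs_edge[OF xy] edges[of x y] by auto
    then have "(x, y) \<in> strong R u" using K xy by (simp add: strong_def)
    then show "(x, y) \<in> A \<union> B" unfolding strong_eq .
  qed
  then have RAB': "del u v (\<lambda>x. - c x) \<subseteq> A\<inverse> \<union> B\<inverse>" unfolding arcs_uminus by blast
  define Dout where "Dout = {x. \<exists>y z. (x, y) \<in> R \<and> (x, z) \<in> R \<and> y \<noteq> z}"
  define Din where "Din = {x. \<exists>y z. (y, x) \<in> R \<and> (z, x) \<in> R \<and> y \<noteq> z}"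
  have "x = y" if "x \<in> Dout" "y \<in> Dout" for x y
    using that branch_unique[OF _ _ _ _ _ _ RAB] unfolding Dout_def by blast
  then obtain s where s: "Dout \<subseteq> {s}" by blast
  have "x = y" if "x \<in> Din" "y \<in> Din" for x y
    using that rev.branch_unique[OF _ _ _ _ _ _ RAB'] unfolding Din_def arcs_uminus by blast
  then obtain t where t: "Din \<subseteq> {t}" by blast
  have "x \<in> {u, v, s, t}" if x: "x \<in> V" for x
  proof (rule ccontr)
    assume not: "x \<notin> {u, v, s, t}"
    then have "x \<notin> Dout" "x \<notin> Din" using s t by auto
    have out: "y = z" if "(x, y) \<in> R" "(x, z) \<in> R" for y z
      using that \<open>x \<notin> Dout\<close> unfolding Dout_def by blast
    have inn: "y = z" if "(y, x) \<in> R" "(z, x) \<in> R" for y z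
      using that \<open>x \<notin> Din\<close> unfolding Din_def by blast
    have "\<exists>a. {y. (x, y) \<in> R} \<subseteq> {a}" using out by blast
    moreover have "\<exists>b. {y. (y, x) \<in> R} \<subseteq> {b}" using inn by blast
    ultimately obtain a b where ab: "{y. (x, y) \<in> R} \<subseteq> {a}" "{y. (y, x) \<in> R} \<subseteq> {b}" by blast
    have "{y. {x, y} \<in> E} \<subseteq> {a, b}"
    proof
      fix y assume "y \<in> {y. {x, y} \<in> E}"
      then have "{x, y} \<in> E - {{u, v}}" using not by (auto simp: doubleton_eq_iff)
      then show "y \<in> {a, b}" using arcs_total[OF col] ab by blast
    qed
    then have "card {y. {x, y} \<in> E} \<le> card {a, b}" by (intro card_mono) simp_all
    also have "\<dots> \<le> 2" by (simp add: card_insert_if)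
    finally show False using degree3[OF x] by simp
  qed
  then have "V \<subseteq> {u, v, s, t}" by blast
  then have "card V \<le> card {u, v, s, t}" by (intro card_mono) simp_all
  also have "\<dots> \<le> 4" by (simp add: card_insert_if)
  finally have le4: "card V \<le> 4" .
  have nbr: "{y. {x, y} \<in> E} = V - {x}" "card V = 4" if x: "x \<in> V" for x
  proof -
    have sub: "{y. {x, y} \<in> E} \<subseteq> V - {x}" using edges by blast
    then have "3 \<le> card (V - {x})" using degree3[OF x] card_mono[OF _ sub] finite_V by simp
    then show "card V = 4" using le4 x finite_V by simp
    then have "card (V - {x}) \<le> card {y. {x, y} \<in> E}" using degree3[OF x] x finite_V by simp
    then show "{y. {x, y} \<in> E} = V - {x}" using card_seteq[OF _ sub] finite_V by simp
  qed
  have "u \<in> V" using edges[OF uv_edge] by blast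
  moreover have "E = [V]\<^bsup>2\<^esup>"
  proof
    show "E \<subseteq> [V]\<^bsup>2\<^esup>"
    proof
      fix e assume e: "e \<in> E"
      then obtain x y where "e = {x, y}" using edge_pair by blast
      then show "e \<in> [V]\<^bsup>2\<^esup>" using edges e by (auto simp: nsets_def)
    qed
    show "[V]\<^bsup>2\<^esup> \<subseteq> E"
    proof
      fix e assume "e \<in> [V]\<^bsup>2\<^esup>"
      then have "e \<subseteq> V" "card e = 2" by (auto simp: nsets_def)
      then obtain x y where "e = {x, y}" "x \<noteq> y" "x \<in> V" "y \<in> V" by (auto simp: card_2_iff)
      then show "e \<in> E" using nbr(1)[of x] by blast
    qed
  qed
  ultimately show ?thesis using nbr(2) finite_V by (simp add: complete_graph_def)
qed

end

text \<open>In the remaining case a vertex \<open>w\<close> lies outside the strong component. It is on no zero cycle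
  but \<open>C1\<close> and \<open>C2\<close>, and these cannot have a common edge at \<open>w\<close>.\<close>

locale outside_vertex = four_zero_cycles +
  fixes w :: 'a
  assumes w: "w \<in> V" "w \<notin> Field A" "w \<notin> Field B"
begin

text \<open>After deleting \<open>g\<close>, a directed cycle passes through \<open>w\<close>; it is
  neither \<open>A\<close> nor \<open>B\<close>, which miss \<open>w\<close>.\<close>

lemma w_avoid:
  assumes "g \<in> E" "w \<in> g"
  shows "\<exists>C \<in> {C1, C2}. w \<in> \<Union> C \<and> g \<notin> C"
proof -
  obtain y where g: "g = {w, y}" using edge_pair[OF assms(1)] assms(2) by fastforce
  obtain c' where c': "coloring3 (E - {{w, y}}) c'" using critical assms(1) g by blast
  obtain X where X: "X \<in> dcycles (del w y c')" "w \<in> Field X"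
    using through_vertex[OF _ c'] assms(1) g by blast
  have "undirected X \<in> ZC" "g \<notin> undirected X" using dcycle_ZC[OF X(1)] g by blast+
  moreover have "w \<in> \<Union> (undirected X)" "w \<notin> \<Union> (undirected A)" "w \<notin> \<Union> (undirected B)"
    using X(2) w by (simp_all only: Union_undirected not_False_eq_True)
  ultimately have "undirected X \<in> {C1, C2}" using ZC_cases[of "undirected X"] by fastforce
  then show ?thesis using \<open>w \<in> \<Union> (undirected X)\<close> \<open>g \<notin> undirected X\<close> by blast
qed

lemma C_edges: "C1 \<subseteq> E" "C2 \<subseteq> E"
  using ZC_edges ZC_mem by blast+

lemma w_disjoint: "g \<in> C1 \<Longrightarrow> g \<in> C2 \<Longrightarrow> w \<notin> g"
  using w_avoid[of g] C_edges by blast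

lemma w_in: "w \<in> \<Union> C1" "w \<in> \<Union> C2"
proof -
  obtain y where "{w, y} \<in> E" using not_isolated w(1) by blast
  then obtain C where C: "C \<in> {C1, C2}" "w \<in> \<Union> C" using w_avoid[of "{w, y}"] by blast
  then obtain g where g: "g \<in> C" "w \<in> g" by blast
  then have "g \<in> E" using C C_edges by blast
  then obtain C' where C': "C' \<in> {C1, C2}" "w \<in> \<Union> C'" "g \<notin> C'" using w_avoid[OF _ g(2)] by blast
  then have "C \<noteq> C'" using g by blast
  then show "w \<in> \<Union> C1" "w \<in> \<Union> C2" using C C' by auto
qed

text \<open>As directed cycles of one digraph, \<open>C1\<close> and \<open>C2\<close> would branch
  at \<open>w\<close> and, having the edge \<open>{u, v}\<close> in common, at a second vertex too.
  Switching in both ways gives two more zero cycles, and \<open>D\<close> is a fifth because it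
  contains the missing edge.\<close>

lemma not_both_directed:
  assumes c': "coloring3 (E - {{x, y}}) c'" and D: "D \<in> ZC" "{x, y} \<in> D"
    and X1: "X1 \<in> dcycles (del x y c')" "undirected X1 = C1"
    and X2: "X2 \<in> dcycles (del x y c')" "undirected X2 = C2"
  shows False
proof -
  have sub: "X1 \<subseteq> del x y c'" "X2 \<subseteq> del x y c'" using X1 X2 dcyclesD by blast+
  have wX: "w \<in> Field X1" "w \<in> Field X2" using w_in X1(2) X2(2) Union_undirected by metis+
  obtain d1 d2 where d: "(w, d1) \<in> X1" "(w, d2) \<in> X2"
    using dcycles_out[OF X1(1) wX(1)] dcycles_out[OF X2(1) wX(2)] by blast
  have common: "z \<noteq> w" "y \<noteq> w" if "(y, z) \<in> X1" "(y, z) \<in> X2" for y z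
    using w_disjoint[of "{y, z}"] undirected_memI[OF that(1)] undirected_memI[OF that(2)] X1(2) X2(2) by auto
  then have dd: "d1 \<noteq> d2" using d by blast
  obtain a b where ab: "(a, b) \<in> X1" "{a, b} = {u, v}"
    using uv_C(1) X1(2) unfolding undirected_def by force
  have ab2: "(a, b) \<in> X2"
    using undirected_mem[OF sub(2), of a b] ab uv_C(2) X2(2) sub(1) by auto
  have "\<exists>s a1 a2. s \<noteq> w \<and> (s, a1) \<in> X1 \<and> (s, a2) \<in> X2 \<and> a1 \<noteq> a2"
  proof (rule ccontr)
    \<comment> \<open>Without a second branching vertex the two cycles agree from the common arc
      \<open>(a, b)\<close> up to \<open>w\<close>, so they share an edge at
      \<open>w\<close>.\<close>
    assume "\<not> ?thesis"
    then have eq: "a1 = a2" if "s \<noteq> w" "(s, a1) \<in> X1" "(s, a2) \<in> X2" for s a1 a2 using that by blast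
    have "\<exists>r. (r, z) \<in> X1 \<and> (r, z) \<in> X2" if "(b, z) \<in> (X1 - {w} \<times> UNIV)\<^sup>*" for z
      using that
    proof (induction rule: rtrancl_induct)
      case base
      show ?case using ab ab2 by blast
    next
      case (step y z)
      then obtain r where "(r, y) \<in> X2" by blast
      then have "y \<in> Field X2" by (auto simp: Field_def)
      then obtain z' where z': "(y, z') \<in> X2" using dcycles_out[OF X2(1)] by blast
      moreover have "(y, z) \<in> X1" "y \<noteq> w" using step(2) by auto
      ultimately show ?case using eq by blast
    qed
    moreover have "(b, w) \<in> (X1 - {w} \<times> UNIV)\<^sup>*"
      by (rule rtrancl_no_leave, rule dcycles_connected[OF X1(1) _ wX(1)]) (use ab in \<open>auto simp: Field_def\<close>)
    ultimately show False using common by blast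
  qed
  then obtain s a1 a2 where s: "s \<noteq> w" "(s, a1) \<in> X1" "(s, a2) \<in> X2" "a1 \<noteq> a2" by blast
  obtain Y where Y: "Y \<in> dcycles (del x y c')" "Y \<noteq> X1" "Y \<noteq> X2" "(s, a1) \<in> Y"
    using dcycles_switch[OF X1(1) X2(1) s(2-4) d dd s(1)] by blast
  obtain Z where Z: "Z \<in> dcycles (del x y c')" "Z \<noteq> X2" "Z \<noteq> X1" "(s, a2) \<in> Z"
    using dcycles_switch[OF X2(1) X1(1) s(3,2) s(4)[symmetric] d(2,1) dd[symmetric] s(1)] by blast
  have "Y \<noteq> Z" using dcycles_out_unique[OF Y(1)] Y(4) Z(4) s(4) by blast
  moreover have "X1 \<noteq> X2" using X1(2) X2(2) C12 by blast
  moreover have "inj_on undirected (dcycles (del x y c'))"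
    using undirected_inj dcyclesD by (metis inj_onI)
  ultimately have "card (undirected ` {X1, X2, Y, Z}) = 4"
    using X1(1) X2(1) Y Z by (subst card_image) (auto simp: inj_on_def)
  moreover have "D \<notin> undirected ` {X1, X2, Y, Z}"
    using D(2) dcycle_ZC(2) X1(1) X2(1) Y(1) Z(1) by blast
  ultimately have "card (insert D (undirected ` {X1, X2, Y, Z})) = 5" by simp
  moreover have "card (insert D (undirected ` {X1, X2, Y, Z})) \<le> card ZC"
    using D(1) dcycle_ZC(1) X1(1) X2(1) Y(1) Z(1) by (intro card_mono[OF finite_ZC]) blast
  ultimately show False using card_ZC by simp
qed

lemma AB_disjoint: "A \<inter> B = {}"
proof (rule ccontr)
  assume "\<not> ?thesis"
  then obtain x y where xy: "(x, y) \<in> A" "(x, y) \<in> B" by auto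
  have "(x, y) \<in> R" using xy AR by blast
  from arcs_edge[OF this] have e: "{x, y} \<in> E" by simp
  obtain c' where c': "coloring3 (E - {{x, y}}) c'" using critical[OF e] by blast
  have xyA: "{x, y} \<in> undirected A" using xy(1) by (rule undirected_memI)
  obtain X1 X2 where "X1 \<in> dcycles (del x y c')" "X2 \<in> dcycles (del x y c')"
    "undirected X1 = C1" "undirected X2 = C2"
    using AB_edge_pair[OF e xyA undirected_memI[OF xy(2)] c'] by blast
  then show False using not_both_directed[OF c' ZC_mem(1) xyA] by blast
qed

lemma reversed': "outside_vertex V E u v (\<lambda>x. - c x) (A\<inverse>) (B\<inverse>) C1 C2 w"
  using reversed w by (simp add: outside_vertex_def outside_vertex_axioms_def)

lemma swapped': "outside_vertex V E u v c B A C1 C2 w"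
  using swapped w by (simp add: outside_vertex_def outside_vertex_axioms_def)

lemma ends_swapped': "outside_vertex V E v u c A B C1 C2 w"
  using ends_swapped w by (simp add: outside_vertex_def outside_vertex_axioms_def)

text \<open>After the exchange the listed arcs of \<open>A\<close> lie on directed cycles. These are
  not \<open>A\<close>, which contains \<open>{x, y}\<close>, nor \<open>B\<close>, which is
  disjoint from \<open>A\<close>. So they are \<open>C1\<close> or \<open>C2\<close>, and always the
  same one since the two are not both directed.\<close>

lemma cut_A:
  assumes f: "(x, y) \<in> A" and no: "(u, v) \<notin> (R - {(x, y)})\<^sup>*"
  shows "\<exists>C \<in> {C1, C2}. {x, y} \<notin> C \<and> (\<forall>p q. (p, q) \<in> A - {(x, y)} \<longrightarrow>
      (u, p) \<in> (R - {(x, y)})\<^sup>* \<and> (q, x) \<in> (R - {(x, y)})\<^sup>* \<or>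
      (y, p) \<in> (R - {(x, y)})\<^sup>* \<and> (q, v) \<in> (R - {(x, y)})\<^sup>* \<longrightarrow> {p, q} \<in> C)"
proof -
  have fR: "(x, y) \<in> R" using f AR by blast
  from cut[OF uv_edge col fR no] obtain c' Z0 where c': "coloring3 (E - {{x, y}}) c'"
    and Z0: "Z0 \<in> dcycles (del x y c')" "(v, u) \<in> Z0"
    and arcs: "\<And>p q. (p, q) \<in> R - {(x, y)} \<Longrightarrow>
      (u, p) \<in> (R - {(x, y)})\<^sup>* \<and> (q, x) \<in> (R - {(x, y)})\<^sup>* \<or>
      (y, p) \<in> (R - {(x, y)})\<^sup>* \<and> (q, v) \<in> (R - {(x, y)})\<^sup>* \<Longrightarrow>
      \<exists>Z \<in> dcycles (del x y c'). (p, q) \<in> Z" by blast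
  have xyA: "{x, y} \<in> undirected A" using f by (rule undirected_memI)
  have "{u, v} \<in> undirected Z0" using undirected_memI[OF Z0(2)] by (simp add: insert_commute)
  then have Z0C: "undirected Z0 = C1 \<or> undirected Z0 = C2" by (rule ZC_through[OF dcycle_ZC(1)[OF Z0(1)]])
  have "{p, q} \<in> undirected Z0" if pq: "(p, q) \<in> A - {(x, y)}" and Z: "Z \<in> dcycles (del x y c')" "(p, q) \<in> Z" for p q Z
  proof -
    have "undirected Z \<noteq> undirected A" using dcycle_ZC(2)[OF Z(1)] xyA by auto
    moreover have "(p, q) \<in> R" "(p, q) \<notin> B" using pq AR AB_disjoint by blast+
    then have "{p, q} \<notin> undirected B" using undirected_mem[OF BR] by blast
    then have "undirected Z \<noteq> undirected B" using undirected_memI[OF Z(2)] by auto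
    ultimately have "undirected Z = C1 \<or> undirected Z = C2" using ZC_cases[OF dcycle_ZC(1)[OF Z(1)]] by blast
    then have "undirected Z = undirected Z0"
      using Z0C not_both_directed[OF c' dcycle_ZC(1)[OF A] xyA] Z(1) Z0(1) by metis
    then show ?thesis using undirected_memI[OF Z(2)] by simp
  qed
  then have "\<forall>p q. (p, q) \<in> A - {(x, y)} \<longrightarrow>
      (u, p) \<in> (R - {(x, y)})\<^sup>* \<and> (q, x) \<in> (R - {(x, y)})\<^sup>* \<or>
      (y, p) \<in> (R - {(x, y)})\<^sup>* \<and> (q, v) \<in> (R - {(x, y)})\<^sup>* \<longrightarrow> {p, q} \<in> undirected Z0"
    using arcs AR by blast
  then show ?thesis using Z0C dcycle_ZC(2)[OF Z0(1)] by blast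
qed

lemma first_arc:
  assumes st: "(s, t) \<in> R\<^sup>*" "(t, s) \<in> R\<^sup>*" "s \<noteq> t"
  shows "\<exists>a. (s, a) \<in> R \<and> (s, t) \<notin> (R - {(s, a)})\<^sup>*"
proof (rule unique_dcycles_cut[OF _ st])
  fix X Y h assume "X \<in> dcycles R" "Y \<in> dcycles R" "h \<in> X" "h \<in> Y"
  then show "X = Y" using dcycles_eq AB_disjoint by blast
qed

text \<open>For \<open>k\<close> at least 3, the first and the last arc of the segment of
  \<open>A\<close> from \<open>u\<close> to \<open>p k\<close> both cut \<open>u\<close> from
  \<open>v\<close>. Exchanging at the first gives a cycle with \<open>{p 1, p 2}\<close> but without
  \<open>{p 0, p 1}\<close>; exchanging at the last gives one with both. Together with
  \<open>A\<close>, three zero cycles then pass through \<open>{p 1, p 2}\<close>.\<close>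

lemma separator_near:
  assumes per: "periodic n p" and Ap: "A = steps p" and p0: "p 0 = u" and k: "0 < k" "k < n"
    and sep: "\<And>f. f \<in> A \<Longrightarrow> (u, v) \<in> (R - {f})\<^sup>* \<Longrightarrow> (u, p k) \<in> (R - {f})\<^sup>*"
    and rest: "(p k, v) \<in> (R - A)\<^sup>*"
  shows "k \<le> 2"
proof (rule ccontr)
  assume "\<not> k \<le> 2"
  then have k3: "3 \<le> k" by simp
  have arc: "(p i, p (i + 1)) \<in> A" for i unfolding Ap by (rule stepsI)
  have inj: "i = j" if "p i = p j" "0 \<le> i" "i < n" "0 \<le> j" "j < n" for i j
    using periodic_eqD[OF per] that by blast
  have walk: "(p i, p j) \<in> (R - {(p m, p (m + 1))})\<^sup>*"
    if ij: "0 \<le> i" "i \<le> j" "j \<le> k" "0 \<le> m" "m < k" "m < i \<or> j \<le> m" for i j m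
  proof -
    have "(p i, p (i + (j - i))) \<in> (R - {(p m, p (m + 1))})\<^sup>*"
    proof (rule steps_walk)
      fix r assume r: "i \<le> r" "r < i + (j - i)"
      then have "p r \<noteq> p m" using inj[of r m] ij k by auto
      then show "(p r, p (r + 1)) \<in> R - {(p m, p (m + 1))}" using arc AR by blast
    qed (use ij in simp)
    then show ?thesis by simp
  qed
  have A_conn: "(p i, p j) \<in> R\<^sup>*" for i j
    by (rule set_rev_mp[OF _ rtrancl_mono[OF AR]])
      (rule dcycles_connected[OF A]; use Field_steps[of p] Ap in auto)
  have neq: "u \<noteq> p k" using inj[of 0 k] k p0 by auto
  have "\<exists>a. (u, a) \<in> R \<and> (u, p k) \<notin> (R - {(u, a)})\<^sup>*"
    using first_arc[of u "p k"] A_conn[of 0 k] A_conn[of k 0] neq p0 by simp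
  then obtain a where a: "(u, a) \<in> R" "(u, p k) \<notin> (R - {(u, a)})\<^sup>*" by blast
  \<comment> \<open>The segment of \<open>A\<close> itself leads from \<open>u\<close> to
    \<open>p k\<close>, and its only arc leaving \<open>u\<close> is
    \<open>(p 0, p 1)\<close>.\<close>
  have "a = p 1"
  proof (rule ccontr)
    assume "a \<noteq> p 1"
    have "(p 0, p (0 + k)) \<in> (R - {(u, a)})\<^sup>*"
    proof (rule steps_walk)
      fix r assume r: "0 \<le> r" "r < 0 + k"
      have "p r \<noteq> u \<or> r = 0" using inj[of r 0] r k p0 by auto
      then show "(p r, p (r + 1)) \<in> R - {(u, a)}" using arc[of r] AR \<open>a \<noteq> p 1\<close> by auto
    qed (use k in simp)
    then show False using a p0 by simp
  qed
  then have cut1: "(u, v) \<notin> (R - {(p 0, p 1)})\<^sup>*" using a(2) sep arc[of 0] p0 by auto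
  interpret rev: outside_vertex V E u v "\<lambda>x. - c x" "A\<inverse>" "B\<inverse>" C1 C2 w by (rule reversed')
  have "\<exists>z. (p k, z) \<in> R\<inverse> \<and> (p k, u) \<notin> (R\<inverse> - {(p k, z)})\<^sup>*"
    using rev.first_arc[of "p k" u] A_conn[of 0 k] A_conn[of k 0] neq p0
    by (simp add: arcs_uminus rtrancl_converse)
  then obtain z where z: "(z, p k) \<in> R" "(p k, u) \<notin> (R\<inverse> - {(p k, z)})\<^sup>*" by blast
  have "R\<inverse> - {(p k, z)} = (R - {(z, p k)})\<inverse>" by auto
  then have z': "(u, p k) \<notin> (R - {(z, p k)})\<^sup>*" using z(2) by (simp add: rtrancl_converse)
  have "z = p (k - 1)"
  proof (rule ccontr)
    assume "z \<noteq> p (k - 1)"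
    have "(p 0, p (0 + k)) \<in> (R - {(z, p k)})\<^sup>*"
    proof (rule steps_walk)
      fix r assume r: "0 \<le> r" "r < 0 + k"
      have "p (r + 1) \<noteq> p k \<or> r = k - 1" using inj[of "r + 1" k] r k by auto
      then show "(p r, p (r + 1)) \<in> R - {(z, p k)}" using arc[of r] AR \<open>z \<noteq> p (k - 1)\<close> by auto
    qed (use k in simp)
    then show False using z' p0 by simp
  qed
  then have cut2: "(u, v) \<notin> (R - {(p (k - 1), p k)})\<^sup>*" using z' sep arc[of "k - 1"] by auto
  have rest': "(p k, v) \<in> (R - {f})\<^sup>*" if "f \<in> A" for f
    using rest by (rule set_rev_mp[OF _ rtrancl_mono]) (use that in blast)
  have arc01: "(p 0, p 1) \<in> A" using arc[of 0] by simp
  obtain D1 where D1: "D1 \<in> {C1, C2}" "{p 0, p 1} \<notin> D1"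
    "\<And>a b. (a, b) \<in> A - {(p 0, p 1)} \<Longrightarrow> (p 1, a) \<in> (R - {(p 0, p 1)})\<^sup>* \<Longrightarrow>
       (b, v) \<in> (R - {(p 0, p 1)})\<^sup>* \<Longrightarrow> {a, b} \<in> D1"
    using cut_A[OF arc01 cut1] by blast
  have arck: "(p (k - 1), p k) \<in> A" using arc[of "k - 1"] by simp
  obtain D2 where D2: "D2 \<in> {C1, C2}"
    "\<And>a b. (a, b) \<in> A - {(p (k - 1), p k)} \<Longrightarrow> (u, a) \<in> (R - {(p (k - 1), p k)})\<^sup>* \<Longrightarrow>
       (b, p (k - 1)) \<in> (R - {(p (k - 1), p k)})\<^sup>* \<Longrightarrow> {a, b} \<in> D2"
    using cut_A[OF arck cut2] by blast
  have "{p 1, p 2} \<in> D1"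
  proof (rule D1(3))
    have "p 1 \<noteq> p 0" using inj[of 1 0] k k3 by auto
    then show "(p 1, p 2) \<in> A - {(p 0, p 1)}" using arc[of 1] by simp
    show "(p 2, v) \<in> (R - {(p 0, p 1)})\<^sup>*"
      by (rule rtrancl_trans[OF _ rest'[OF arc01]]) (use walk[of 2 k 0] k3 in simp)
  qed simp
  moreover have D2I: "{p i, p (i + 1)} \<in> D2" if "0 \<le> i" "i < k - 1" for i
  proof (rule D2(2))
    have "p i \<noteq> p (k - 1)" using inj[of i "k - 1"] that k by auto
    then show "(p i, p (i + 1)) \<in> A - {(p (k - 1), p k)}" using arc[of i] by simp
    show "(u, p i) \<in> (R - {(p (k - 1), p k)})\<^sup>*" using walk[of 0 i "k - 1"] that p0 by simp
    show "(p (i + 1), p (k - 1)) \<in> (R - {(p (k - 1), p k)})\<^sup>*" using walk[of "i + 1" "k - 1" "k - 1"] that by simp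
  qed
  moreover have "{p 0, p 1} \<in> D2" "{p 1, p 2} \<in> D2" using D2I[of 0] D2I[of 1] k3 by simp_all
  moreover have "D1 \<noteq> D2" using D1(2) \<open>{p 0, p 1} \<in> D2\<close> by blast
  moreover have "(p 1, p 2) \<in> A" using arc[of 1] by simp
  then have "{p 1, p 2} \<in> undirected A" by (rule undirected_memI)
  moreover from this have "{p 1, p 2} \<in> E" using ZC_edges[OF ZC_mem(1)] by blast
  moreover have "D1 \<noteq> undirected A" "D2 \<noteq> undirected A" using D1(1) D2(1) uv_C uv_not_AB by blast+
  moreover have "D1 \<in> ZC" "D2 \<in> ZC" "undirected A \<in> ZC" using D1(1) D2(1) ZC_mem by blast+
  ultimately show False using at_most_two[of "{p 1, p 2}" D1 D2 "undirected A"] by blast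
qed

lemma Field_A_param:
  assumes "s \<in> Field A" shows "\<exists>n p. periodic n p \<and> A = steps p \<and> p 0 = s"
proof -
  obtain n q where q: "periodic n q" "A = steps q" using A by (auto simp: dcycles_def)
  obtain k where "s = q k" using assms unfolding q(2) Field_steps by blast
  then show ?thesis using periodic_shift[OF q(1), of k] steps_shift[of q k] q(2)
    by (intro exI[of _ n] exI[of _ "\<lambda>i. q (k + i)"]) simp
qed

text \<open>Equal colours put \<open>v\<close> at least three steps after \<open>u\<close> on
  \<open>A\<close>, while \<open>separator_near\<close> with \<open>p k = v\<close> allows at most
  two.\<close>

lemma not_both_on_A: "\<not> (u \<in> Field A \<and> v \<in> Field A)"
proof
  assume uv: "u \<in> Field A \<and> v \<in> Field A"
  then obtain n p where p: "periodic n p" "A = steps p" "p 0 = u" using Field_A_param by blast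
  have "v \<in> range p" using uv Field_steps[of p] p(2) by simp
  then obtain l where l: "0 \<le> l" "l < n" "v = p l" using periodic_range[OF p(1)] by blast
  have "l \<noteq> 0" using l p u_v(3) by auto
  moreover have "3 dvd l - 0"
    by (rule periodic_arcs_dvd[OF p(1), of "E - {{u, v}}" c])
      (use AR p ends_same[OF uv_edge col] l in auto)
  ultimately have "3 \<le> l" using l(1) zdvd_imp_le by fastforce
  moreover have "l \<le> 2"
    by (rule separator_near[OF p]) (use l \<open>l \<noteq> 0\<close> in simp_all)
  ultimately show False by simp
qed

lemma common_vertex_unique:
  assumes "s \<in> Field A" "s \<in> Field B" "t \<in> Field A" "t \<in> Field B" shows "s = t"
proof (rule ccontr)
  assume "s \<noteq> t"
  obtain a b d e where arcs: "(s, a) \<in> A" "(s, b) \<in> B" "(t, d) \<in> A" "(t, e) \<in> B"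
    using assms dcycles_out[OF A] dcycles_out[OF B] by meson
  then have "a \<noteq> b" "d \<noteq> e" using AB_disjoint by blast+
  with dcycles_switch[OF A B arcs(1,2) _ arcs(3,4) _ \<open>s \<noteq> t\<close>] show False using dcycles_eq by blast
qed

text \<open>Walks from \<open>u\<close> to \<open>v\<close> run inside \<open>A\<close> and
  \<open>B\<close>, whose only common vertex is \<open>p k\<close>. A walk missing
  \<open>p k\<close> would stay on \<open>A\<close> and never reach \<open>v\<close>.\<close>

lemma separated_near:
  assumes per: "periodic n p" and Ap: "A = steps p" and p0: "p 0 = u" and k: "0 < k" "k < n"
    and pk: "p k \<in> Field B" and v: "v \<in> Field B" "v \<notin> Field A"
  shows "k \<le> 2"
proof (rule separator_near[OF per Ap p0 k])
  show "(p k, v) \<in> (R - A)\<^sup>*"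
    by (rule set_rev_mp[OF dcycles_connected[OF B pk v(1)] rtrancl_mono]) (use BR AB_disjoint in blast)
  fix f assume f: "f \<in> A" and path: "(u, v) \<in> (R - {f})\<^sup>*"
  have FA: "p i \<in> Field A" for i using Field_steps[of p] Ap by simp
  show "(u, p k) \<in> (R - {f})\<^sup>*"
  proof (rule ccontr)
    assume no: "(u, p k) \<notin> (R - {f})\<^sup>*"
    let ?P = "{(a, b) \<in> R - {f}. (u, a) \<in> (R - {f})\<^sup>* \<and> (b, v) \<in> (R - {f})\<^sup>*}"
    have sub: "(R - {f})\<^sup>* \<subseteq> R\<^sup>*" by (rule rtrancl_mono) blast
    have P: "?P \<subseteq> A \<union> B"
    proof (rule subrelI)
      fix a b assume ab: "(a, b) \<in> ?P"
      then have "(a, b) \<in> R" "(u, a) \<in> R\<^sup>*" "(b, v) \<in> R\<^sup>*" using sub by blast+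
      then have "(a, b) \<in> strong R u" using u_v(2) unfolding strong_def by (simp add: rtrancl_trans[of b v])
      then show "(a, b) \<in> A \<union> B" unfolding strong_eq .
    qed
    have "(u, z) \<in> (R - {f})\<^sup>* \<and> z \<in> Field A" if "(u, z) \<in> ?P\<^sup>*" for z
      using that
    proof (induction rule: rtrancl_induct)
      case base
      show ?case using FA[of 0] p0 by simp
    next
      case (step y z)
      have "y \<noteq> p k" using step(3) no by blast
      then have "y \<notin> Field B" using common_vertex_unique[OF _ _ FA pk] step(3) by blast
      then have "(y, z) \<notin> B" unfolding Field_def by blast
      then have "(y, z) \<in> A" using P step(2) by blast
      then have "z \<in> Field A" unfolding Field_def by blast
      moreover have "(u, z) \<in> (R - {f})\<^sup>*" using step(2,3) by (blast intro: rtrancl_into_rtrancl)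
      ultimately show ?case by blast
    qed
    then show False using rtrancl_between[OF path] v(2) by blast
  qed
qed

text \<open>Along \<open>A\<close> the vertex \<open>t\<close> is at most two steps from
  \<open>u\<close> in either direction, so the length of \<open>A\<close> is at most 4; being a
  multiple of 3, it is 3.\<close>

lemma common_vertex_adjacent:
  assumes u: "u \<in> Field A" "u \<notin> Field B" and v: "v \<in> Field B" "v \<notin> Field A"
    and t: "t \<in> Field A" "t \<in> Field B"
  shows "{u, t} \<in> E"
proof -
  obtain n p where p: "periodic n p" "A = steps p" "p 0 = u" using Field_A_param[OF u(1)] by blast
  have "t \<in> range p" using t(1) Field_steps[of p] p(2) by simp
  then obtain k where k: "0 \<le> k" "k < n" "t = p k" using periodic_range[OF p(1)] by blast
  have k0: "0 < k" using k p t u by (cases "k = 0") auto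
  have "k \<le> 2" by (rule separated_near[OF p k0 k(2)]) (use t k v in auto)
  interpret rev: outside_vertex V E u v "\<lambda>x. - c x" "A\<inverse>" "B\<inverse>" C1 C2 w by (rule reversed')
  have pn: "p (i + n) = p i" for i by (rule periodic_add[OF p(1)])
  have "n - k \<le> 2"
  proof (rule rev.separated_near[OF periodic_reflect[OF p(1)]])
    show "A\<inverse> = steps (\<lambda>i. p (0 - i))" using p(2) steps_reflect[of p 0] by simp
    show "p (0 - 0) = u" using p by simp
    show "p (0 - (n - k)) \<in> Field (B\<inverse>)" using pn[of "k - n"] t k by simp
  qed (use k k0 v in simp_all)
  moreover have "3 dvd n - 0"
    by (rule periodic_arcs_dvd[OF p(1), of "E - {{u, v}}" c]) (use AR p pn[of 0] in auto)
  ultimately have "n = 3" using \<open>k \<le> 2\<close> k k0 by presburger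
  have edge: "{p i, p (i + 1)} \<in> E" for i
    using arcs_edge[of "p i" "p (i + 1)" "E - {{u, v}}" c] stepsI[of p i] p(2) AR by auto
  have "k = 1 \<or> k = 2" using k0 \<open>k \<le> 2\<close> by auto
  then show ?thesis
    using edge[of 0] edge[of 2] pn[of 0] k(3) p(3) \<open>n = 3\<close> by (auto simp: insert_commute)
qed

text \<open>By symmetry \<open>t\<close> is adjacent to both \<open>u\<close> and \<open>v\<close>.
  The triangle through the edge \<open>{u, v}\<close> must be \<open>C1\<close> or \<open>C2\<close>
  and hence contain \<open>w\<close>, but its three vertices all lie on \<open>A\<close> or
  \<open>B\<close>.\<close>

lemma not_separated:
  assumes u: "u \<in> Field A" "u \<notin> Field B" and v: "v \<in> Field B" "v \<notin> Field A"
  shows False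
proof -
  have "\<exists>t. t \<in> Field A \<and> t \<in> Field B"
  proof (rule ccontr)
    assume no: "\<not> ?thesis"
    have "{(a, b) \<in> R. (u, a) \<in> R\<^sup>* \<and> (b, v) \<in> R\<^sup>*} \<subseteq> strong R u"
      using u_v(2) unfolding strong_def by (auto intro: rtrancl_trans)
    then have "(u, v) \<in> (A \<union> B)\<^sup>*"
      using rtrancl_between[OF u_v(1)] rtrancl_mono strong_eq by blast
    then have "v \<in> Field A"
    proof (induction rule: rtrancl_induct)
      case (step y z)
      then show ?case using no unfolding Field_def by blast
    qed (rule u(1))
    then show False using v by blast
  qed
  then obtain t where t: "t \<in> Field A" "t \<in> Field B" by blast
  interpret sw: outside_vertex V E v u c B A C1 C2 w
    using outside_vertex.swapped'[OF ends_swapped'] .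
  have ut: "{u, t} \<in> E" using common_vertex_adjacent[OF u v t] .
  have vt: "{v, t} \<in> E" using sw.common_vertex_adjacent[OF v u t(2,1)] .
  have neq: "u \<noteq> t" "v \<noteq> t" using ut vt edges by blast+
  define T where "T = cycle_edges [u, t, v]"
  have dist: "distinct [u, t, v]" using neq u_v(3) by auto
  have T: "T = {{u, t}, {t, v}, {v, u}}"
  proof -
    have "{i. i < length [u, t, v]} = {0, 1, 2}" by auto
    then show ?thesis unfolding T_def cycle_edges_def setcompr_eq_image by simp
  qed
  have "card T = 3" using card_cycle_edges[OF dist] by (simp add: T_def)
  moreover have "T \<subseteq> E" using ut vt uv_edge by (auto simp: T insert_commute)
  moreover have "\<exists>xs. distinct xs \<and> 3 \<le> length xs \<and> T = cycle_edges xs"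
    using dist by (intro exI[of _ "[u, t, v]"]) (simp add: T_def)
  ultimately have "T \<in> ZC" unfolding zero_cycles_def cycles_def by simp
  moreover have "{u, v} \<in> T" by (auto simp: T)
  ultimately have "T \<in> {C1, C2}" using ZC_through by blast
  then have "w \<in> \<Union> T" using w_in by blast
  then have "w = u \<or> w = t \<or> w = v" by (auto simp: T)
  then show False using w u v t by blast
qed

lemma contradiction: False
proof -
  obtain a where a: "(u, a) \<in> R" "(a, v) \<in> R\<^sup>*" using u_v(1,3) by (auto elim: converse_rtranclE)
  have "(a, u) \<in> R\<^sup>*" using a(2) u_v(2) by (rule rtrancl_trans)
  then have "(u, a) \<in> strong R u" using a by (simp add: strong_def)
  then have u: "u \<in> Field A \<or> u \<in> Field B" unfolding strong_eq Field_def by blast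
  obtain z where z: "(u, z) \<in> R\<^sup>*" "(z, v) \<in> R" using u_v(1,3) by (auto elim: rtranclE)
  then have "(z, v) \<in> strong R u" using u_v(2) by (simp add: strong_def)
  then have v: "v \<in> Field A \<or> v \<in> Field B" unfolding strong_eq Field_def by blast
  interpret sw: outside_vertex V E u v c B A C1 C2 w by (rule swapped')
  show False
    using u v not_both_on_A sw.not_both_on_A not_separated sw.not_separated by blast
qed

end

section \<open>Combining the cases\<close>

context critical4
begin

text \<open>Two zero cycles through a shared edge and two directed ones avoiding it already exhaust
  the four that are allowed.\<close>

theorem few_zero_cycles:
  assumes few: "card ZC \<le> 4"
  shows "card ZC = 4 \<and> complete_graph 4 V E"
proof -
  obtain C1 C2 e where C: "C1 \<in> ZC" "C2 \<in> ZC" "C1 \<noteq> C2" "e \<in> C1" "e \<in> C2"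
    using zero_cycles_share_edge by blast
  then have eE: "e \<in> E" using ZC_edges by blast
  obtain u v where e: "e = {u, v}" using edge_pair[OF eE] by blast
  have uv: "{u, v} \<in> E" using eE e by simp
  obtain c where c: "coloring3 (E - {{u, v}}) c" using critical[OF uv] by blast
  obtain A B where AB: "A \<in> dcycles (del u v c)" "B \<in> dcycles (del u v c)" "A \<noteq> B"
    "A \<subseteq> strong (del u v c) u" "B \<subseteq> strong (del u v c) u"
    using two_dcycles[OF uv c few] by blast
  have neq: "undirected A \<noteq> undirected B" using AB undirected_inj dcyclesD by metis
  have not_in: "e \<notin> undirected A" "e \<notin> undirected B" using dcycle_ZC(2) AB e by blast+
  then have "undirected A \<noteq> C1" "undirected A \<noteq> C2" "undirected B \<noteq> C1" "undirected B \<noteq> C2"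
    using C(4,5) by auto
  then have "card {undirected A, undirected B, C1, C2} = 4" using neq C(3) by simp
  moreover have sub: "{undirected A, undirected B, C1, C2} \<subseteq> ZC" using C dcycle_ZC(1) AB by blast
  ultimately have eq: "{undirected A, undirected B, C1, C2} = ZC"
    using few by (intro card_seteq[OF finite_ZC sub]) simp
  interpret four_zero_cycles V E u v c A B C1 C2
    by unfold_locales (use uv c AB eq C e in auto)
  have "complete_graph 4 V E"
  proof (rule spanning_complete, rule subsetI, rule ccontr)
    fix w assume "w \<in> V" "w \<notin> Field A \<union> Field B"
    then interpret outside_vertex V E u v c A B C1 C2 w by unfold_locales auto
    show False by (rule contradiction)
  qed
  then show ?thesis using card_ZC by blast
qed

end

section \<open>From chromatic numbers to colourings modulo 3\<close>

lemma three_colorable: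
  assumes "simple_graph V E" "chromatic_number V E < 4"
  shows "\<exists>c. coloring3 E c"
proof -
  obtain c where c: "proper_coloring V E (chromatic_number V E) c"
    using ex_proper_coloring[OF assms(1)] LeastI_ex[of "\<lambda>k. \<exists>c. proper_coloring V E k c"]
    unfolding chromatic_number_def by blast
  have "int (c x) mod 3 \<noteq> int (c y) mod 3" if xy: "{x, y} \<in> E" for x y
  proof -
    have "{x, y} \<subseteq> V" using xy assms(1) by (auto simp: simple_graph_def nsets_def)
    then have "c x < 3" "c y < 3" using c assms(2) unfolding proper_coloring_def by fastforce+
    moreover have "c x \<noteq> c y" using c xy unfolding proper_coloring_def by blast
    ultimately show ?thesis by simp
  qed
  then show ?thesis unfolding coloring3_def by (intro exI[of _ "\<lambda>x. int (c x)"]) blast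
qed

lemma critical_critical4:
  assumes "critical 4 V E" shows "critical4 V E"
proof -
  have G: "simple_graph V E" and chi: "chromatic_number V E = 4"
    and sub: "\<And>V' E'. proper_subgraph V' E' V E \<Longrightarrow> chromatic_number V' E' < 4"
    using assms by (auto simp: critical_def)
  have not_col: "\<not> coloring3 E c" for c
  proof
    assume c: "coloring3 E c"
    have "nat (a mod 3) = nat (b mod 3) \<longleftrightarrow> a mod 3 = b mod 3" for a b :: int by (simp add: eq_nat_nat_iff)
    moreover have "nat (a mod 3) < 3" for a :: int by (simp add: nat_less_iff)
    ultimately have "proper_coloring V E 3 (\<lambda>x. nat (c x mod 3))"
      using c unfolding proper_coloring_def coloring3_def by blast
    then have "chromatic_number V E \<le> 3" unfolding chromatic_number_def by (intro Least_le) blast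
    then show False using chi by simp
  qed
  show ?thesis
  proof
    show "finite V" using G by (simp add: simple_graph_def)
    show "x \<in> V \<and> y \<in> V \<and> x \<noteq> y" if "{x, y} \<in> E" for x y
    proof -
      have "{x, y} \<subseteq> V" "card {x, y} = 2" using that G by (auto simp: simple_graph_def nsets_def)
      then show ?thesis by (auto simp: card_insert_if split: if_splits)
    qed
    show "\<exists>x y. e = {x, y}" if "e \<in> E" for e
    proof -
      have "card e = 2" using that G by (auto simp: simple_graph_def nsets_def)
      then show ?thesis by (auto simp: card_2_iff)
    qed
    show "\<not> coloring3 E c" for c by (rule not_col)
    show "\<exists>c. coloring3 (E - {e}) c" if "e \<in> E" for e
    proof -
      have "simple_graph V (E - {e})" using G by (auto simp: simple_graph_def)
      moreover from this have "proper_subgraph V (E - {e}) V E"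
        using that by (auto simp: proper_subgraph_def subgraph_def)
      ultimately show ?thesis using three_colorable sub by blast
    qed
    show "\<exists>y. {x, y} \<in> E" if "x \<in> V" for x
    proof (rule ccontr)
      assume no: "\<not> ?thesis"
      have "e \<in> [V - {x}]\<^bsup>2\<^esup>" if e: "e \<in> E" for e
      proof -
        have "e \<subseteq> V" "finite e" "card e = 2" using e G by (auto simp: simple_graph_def nsets_def)
        moreover have "x \<notin> e"
        proof
          assume "x \<in> e"
          then obtain y where "e = {x, y}" using \<open>card e = 2\<close> by (auto simp: card_2_iff)
          then show False using no e by blast
        qed
        ultimately show ?thesis by (auto simp: nsets_def)
      qed
      then have "simple_graph (V - {x}) E" using G by (auto simp: simple_graph_def)
      moreover from this have "proper_subgraph (V - {x}) E V E"
        using \<open>x \<in> V\<close> by (auto simp: proper_subgraph_def subgraph_def)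
      ultimately show False using three_colorable sub not_col by blast
    qed
  qed
qed

theorem theorem1:
  fixes V :: "'a set" and E :: "'a set set"
  assumes "critical 4 V E"
  shows "card {C \<in> cycles E. 3 dvd card C} \<ge> 4 \<and>
         (card {C \<in> cycles E. 3 dvd card C} = 4 \<longrightarrow> complete_graph 4 V E)"
proof -
  interpret critical4 V E using assms by (rule critical_critical4)
  show ?thesis using few_zero_cycles unfolding zero_cycles_def by linarith
qed

end
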